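(* Let $\alpha,\beta>0$, let $X_{0-}\ge0$, $Y_{0-}\le0$ be random variables, and let $\Lambda:[0,\infty)\to\mathbb{R}$ be any solution of the McKean-Vlasov system $$X_t=X_{0-}+B_t-\Lambda_t,\qquad Y_t=Y_{0-}+W_t-\Lambda_t,\qquad \Lambda_t=\alpha\,\mathbb{P}(\sigma\le t)-\beta\,\mathbb{P}(\tau\le t),\qquad t\ge 0,$$ where $\sigma:=\inf\{t\ge 0: X_t\le 0\}$ and $\tau:=\inf\{t\ge 0: Y_t\ge 0\}$. Then for every $t$ with $\Lambda_t\neq\Lambda_{t-}$ the jump size satisfies $$|\Lambda_t-\Lambda_{t-}|\ \ge\ \begin{cases}\inf\{x>0:\ \alpha\,\mathbb{P}(\sigma\ge t,\ X_{t-}\in[0,x])<x\} & \text{if } \Lambda_t-\Lambda_{t-}>0,\\ \inf\{y>0:\ \beta\,\mathbb{P}(\tau\ge t,\ Y_{t-}\in[-y,0])<y\} & \text{if } \Lambda_t-\Lambda_{t-}<0.\end{cases}$$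
   Context: A solution of the system is a (deterministic) right-continuous function with left limits $\Lambda:[0,\infty)\to\mathbb{R}$ such that the displayed equations hold, where $B$, $W$ are standard Brownian motions independent of $X_{0-}$, $Y_{0-}$, respectively. Left limits are denoted $h(t-):=\lim_{s\uparrow t}h(s)$; at $t=0$ one uses the convention $\Lambda_{0-}=0$, so that the left limits of $X$ and $Y$ at time $0$ are the given initial values $X_{0-}$ and $Y_{0-}$. *)

theory Defs
  imports "HOL-Probability.Probability"
begin

text \<open>Processes are indexed by \<open>real\<close>; only their values at times \<open>t \<ge> 0\<close> matter.\<close>

definition standard_brownian_motion :: "'a measure \<Rightarrow> (real \<Rightarrow> 'a \<Rightarrow> real) \<Rightarrow> bool" where
  "standard_brownian_motion M B \<longleftrightarrow>
     (\<forall>t\<ge>0. B t \<in> borel_measurable M) \<and>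
     (AE \<omega> in M. B 0 \<omega> = 0) \<and>
     (\<forall>(n::nat) (t::nat \<Rightarrow> real). 0 \<le> t 0 \<and> (\<forall>i<n. t i \<le> t (Suc i)) \<longrightarrow>
        prob_space.indep_vars M (\<lambda>_. borel) (\<lambda>i \<omega>. B (t (Suc i)) \<omega> - B (t i) \<omega>) {..<n}) \<and>
     (\<forall>s t. 0 \<le> s \<and> s < t \<longrightarrow>
        distributed M lborel (\<lambda>\<omega>. B t \<omega> - B s \<omega>) (normal_density 0 (sqrt (t - s)))) \<and>
     (AE \<omega> in M. continuous_on {0..} (\<lambda>t. B t \<omega>))"

text \<open>Independence of a real random variable \<open>Z\<close> from the whole process \<open>(B t)\<close>, \<open>t \<ge> 0\<close>.
  The library's \<open>indep_var\<close> needs both variables to have values in the same type, so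
  independence is expressed through the generated \<open>\<sigma>\<close>-algebras.\<close>

definition indep_of_process :: "'a measure \<Rightarrow> ('a \<Rightarrow> real) \<Rightarrow> (real \<Rightarrow> 'a \<Rightarrow> real) \<Rightarrow> bool" where
  "indep_of_process M Z B \<longleftrightarrow>
     prob_space.indep_set M
       (sets (vimage_algebra (space M) Z borel))
       (sets (vimage_algebra (space M) (\<lambda>\<omega>. \<lambda>t\<in>{0..}. B t \<omega>) (Pi\<^sub>M {0..} (\<lambda>_. borel))))"

definition cadlag :: "(real \<Rightarrow> real) \<Rightarrow> bool" where
  "cadlag h \<longleftrightarrow>
     (\<forall>t\<ge>0. continuous (at_right t) h) \<and> (\<forall>t>0. \<exists>l. (h \<longlongrightarrow> l) (at_left t))"

text \<open>\<open>left_lim h0 h t\<close> is \<open>h(t-)\<close>, where \<open>h0\<close> is the value prescribed for \<open>h(0-)\<close>.\<close>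

definition left_lim :: "real \<Rightarrow> (real \<Rightarrow> real) \<Rightarrow> real \<Rightarrow> real" where
  "left_lim h0 h t = (if t = 0 then h0 else Lim (at_left t) h)"

text \<open>With \<open>Z = X0\<close> (respectively \<open>Y0\<close>) and driving process \<open>B\<close> (respectively \<open>W\<close>) this is the
  process \<open>X\<close> (respectively \<open>Y\<close>) of the system.\<close>

definition shifted_process ::
  "('a \<Rightarrow> real) \<Rightarrow> (real \<Rightarrow> 'a \<Rightarrow> real) \<Rightarrow> (real \<Rightarrow> real) \<Rightarrow> real \<Rightarrow> 'a \<Rightarrow> real" where
  "shifted_process Z B \<Lambda> t \<omega> = Z \<omega> + B t \<omega> - \<Lambda> t"

text \<open>Extended real values, so that the infimum of the empty set is \<open>\<infinity>\<close>.\<close>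

definition hit_nonpos :: "(real \<Rightarrow> 'a \<Rightarrow> real) \<Rightarrow> 'a \<Rightarrow> ereal" where
  "hit_nonpos X \<omega> = Inf (ereal ` {t. 0 \<le> t \<and> X t \<omega> \<le> 0})"

definition hit_nonneg :: "(real \<Rightarrow> 'a \<Rightarrow> real) \<Rightarrow> 'a \<Rightarrow> ereal" where
  "hit_nonneg Y \<omega> = Inf (ereal ` {t. 0 \<le> t \<and> Y t \<omega> \<ge> 0})"

text \<open>\<open>prob_of M P\<close> is the probability of the event \<open>P\<close>. It is evaluated in the completion of
  \<open>M\<close> (which agrees with \<open>M\<close> on \<open>sets M\<close>): hitting events of processes with almost surely
  continuous noise need only be measurable up to null sets, while \<open>measure M\<close> is 0 on every set
  outside \<open>sets M\<close>.\<close>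

definition prob_of :: "'a measure \<Rightarrow> ('a \<Rightarrow> bool) \<Rightarrow> real" where
  "prob_of M P = measure (completion M) {\<omega> \<in> space M. P \<omega>}"

definition mckean_vlasov_solution ::
  "'a measure \<Rightarrow> real \<Rightarrow> real \<Rightarrow> ('a \<Rightarrow> real) \<Rightarrow> ('a \<Rightarrow> real) \<Rightarrow>
   (real \<Rightarrow> 'a \<Rightarrow> real) \<Rightarrow> (real \<Rightarrow> 'a \<Rightarrow> real) \<Rightarrow> (real \<Rightarrow> real) \<Rightarrow> bool" where
  "mckean_vlasov_solution M \<alpha> \<beta> X0 Y0 B W \<Lambda> \<longleftrightarrow>
     cadlag \<Lambda> \<and>
     (\<forall>t\<ge>0. \<Lambda> t =
        \<alpha> * prob_of M (\<lambda>\<omega>. hit_nonpos (shifted_process X0 B \<Lambda>) \<omega> \<le> ereal t) -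
        \<beta> * prob_of M (\<lambda>\<omega>. hit_nonneg (shifted_process Y0 W \<Lambda>) \<omega> \<le> ereal t))"

end

theory Submission
  imports Defs
begin

text \<open>
  Suppose that \<open>\<Lambda>\<close> jumps upwards at \<open>t\<close> by \<open>J\<close>, and that \<open>J\<close> is smaller than the infimum in
  question. Then for some \<open>x1 > J\<close> and every \<open>x \<le> x1\<close>, the particles \<open>X\<close> that survive until \<open>t\<close>
  have, just before \<open>t\<close>, at least mass \<open>x / \<alpha>\<close> in \<open>[0, x]\<close>. The idea is that under this condition
  a shift by \<open>J\<close> is not in equilibrium: each shift of the barrier kills enough particles to
  sustain that shift, and the Brownian noise kills some more, so that \<open>\<Lambda>\<close> could not be
  right-continuous at \<open>t\<close>.

  To make this precise, let \<open>D\<close> be the change of \<open>\<Lambda>\<close> from just before \<open>t\<close> to \<open>t + h\<close> and \<open>G\<close> the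
  increment of \<open>B\<close> over \<open>[t, t + h]\<close>. A surviving particle whose position just before \<open>t\<close> is at
  most \<open>max J (D - G)\<close> is non-positive at time \<open>t\<close> or at time \<open>t + h\<close>. Since \<open>G\<close> is independent of
  the past (\<open>past_indep_increment\<close>), the mass condition yields that the particles \<open>X\<close> caught in
  \<open>[t, t + h]\<close> contribute at least the expectation of \<open>min x1 (max J (D - G))\<close> to \<open>D\<close>
  (\<open>prob_hit_between_ge\<close>). As \<open>D - G\<close> has mean \<open>D\<close> and \<open>D\<close> is close to \<open>J\<close>, this expectation is \<open>D\<close>
  plus a gain from the lower truncation minus a loss from the upper one
  (\<open>normal_truncation_gain\<close>). The particles \<open>Y\<close> act in the opposite direction, but they have just
  been moved away from \<open>0\<close> by about \<open>J\<close>, so by a maximal inequality few of them are caught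
  (\<open>prob_hit_between_le\<close>). The gain needs only an arbitrarily small deviation of \<open>G\<close>, the other
  two terms a deviation of fixed size; for small \<open>h\<close> the gain prevails and \<open>D > D\<close> follows
  (\<open>upward_jump_ge\<close>). Downward jumps are reduced to this case by reflecting both processes and
  exchanging their roles.

  Decomposing the change of \<open>\<Lambda>\<close> into the masses caught before and after \<open>t\<close> requires hitting
  events to be measurable up to null sets. This holds because a cadlag barrier has only
  countably many downward jumps and the path almost surely avoids the left limits of the barrier
  there (\<open>ex_le_cadlag_iff_rational\<close>, \<open>no_atom\<close>, \<open>hit_le_AE_hit_by\<close>).
\<close>

section \<open>Hitting times of cadlag paths\<close>

lemma le_hit_nonpos_iff:
  "ereal t \<le> hit_nonpos X \<omega> \<longleftrightarrow> (\<forall>s. 0 \<le> s \<and> s < t \<longrightarrow> 0 < X s \<omega>)"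
proof -
  have "ereal t \<le> hit_nonpos X \<omega> \<longleftrightarrow> (\<forall>s. 0 \<le> s \<and> X s \<omega> \<le> 0 \<longrightarrow> t \<le> s)"
    unfolding hit_nonpos_def by (auto simp: le_Inf_iff)
  then show ?thesis by (metis linorder_not_less)
qed

text \<open>Right-continuity is what makes the infimum attained: if the path is still positive at time \<open>r\<close>,
  it stays positive for a short while, so the hitting time exceeds \<open>r\<close> strictly.\<close>

lemma hit_nonpos_le_iff:
  assumes rc: "\<And>s. 0 \<le> s \<Longrightarrow> continuous (at_right s) (\<lambda>s. X s \<omega>)"
  shows "hit_nonpos X \<omega> \<le> ereal r \<longleftrightarrow> (\<exists>s. 0 \<le> s \<and> s \<le> r \<and> X s \<omega> \<le> 0)"
proof
  assume *: "hit_nonpos X \<omega> \<le> ereal r"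
  show "\<exists>s. 0 \<le> s \<and> s \<le> r \<and> X s \<omega> \<le> 0"
  proof (rule ccontr)
    assume "\<not> ?thesis"
    then have pos: "0 < X s \<omega>" if "0 \<le> s" "s \<le> r" for s
      using that by force
    obtain e where e: "e > r" "\<And>s. 0 \<le> s \<Longrightarrow> s < e \<Longrightarrow> 0 < X s \<omega>"
    proof (cases "0 \<le> r")
      case True
      have "((\<lambda>s. X s \<omega>) \<longlongrightarrow> X r \<omega>) (at_right r)"
        using rc[OF True] by (simp add: continuous_within)
      from order_tendstoD(1)[OF this pos[OF True order_refl]]
      obtain b where "b > r" "\<And>s. r < s \<Longrightarrow> s < b \<Longrightarrow> 0 < X s \<omega>"
        unfolding eventually_at_right_field by blast
      then show ?thesis using pos that[of b] by (meson linorder_not_le)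
    next
      case False
      then show ?thesis using that[of 0] by auto
    qed
    from e(2) have "ereal e \<le> hit_nonpos X \<omega>" unfolding le_hit_nonpos_iff by blast
    also note *
    finally show False using e(1) by simp
  qed
next
  assume "\<exists>s. 0 \<le> s \<and> s \<le> r \<and> X s \<omega> \<le> 0"
  then obtain s where "0 \<le> s" "s \<le> r" "X s \<omega> \<le> 0" by blast
  then have "hit_nonpos X \<omega> \<le> ereal s"
    unfolding hit_nonpos_def by (auto intro!: Inf_lower)
  also have "\<dots> \<le> ereal r" using \<open>s \<le> r\<close> by simp
  finally show "hit_nonpos X \<omega> \<le> ereal r" .
qed

lemma cadlag_right:
  assumes "cadlag f" "0 \<le> t"
  shows "(f \<longlongrightarrow> f t) (at_right t)"
  using assms by (simp add: cadlag_def continuous_within)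

lemma cadlag_left:
  assumes "cadlag f" "0 < t"
  shows "(f \<longlongrightarrow> left_lim h0 f t) (at_left t)"
proof -
  obtain l where l: "(f \<longlongrightarrow> l) (at_left t)" using assms by (auto simp: cadlag_def)
  then have "Lim (at_left t) f = l" by (intro tendsto_Lim) auto
  then show ?thesis using l assms by (simp add: left_lim_def)
qed

lemma left_lim_eq:
  assumes "0 < t" "(f \<longlongrightarrow> l) (at_left t)"
  shows "left_lim h0 f t = l"
  using tendsto_Lim[OF _ assms(2)] assms(1) by (simp add: left_lim_def)

lemma cadlag_uminus:
  assumes "cadlag f" shows "cadlag (\<lambda>t. - f t)"
  using assms unfolding cadlag_def by (auto intro!: continuous_minus) (metis tendsto_minus)

lemma left_lim_uminus:
  assumes "cadlag f" "0 \<le> t"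
  shows "left_lim 0 (\<lambda>t. - f t) t = - left_lim 0 f t"
proof (cases "t = 0")
  case False
  then show ?thesis
    using assms by (intro left_lim_eq tendsto_minus cadlag_left) auto
qed (simp add: left_lim_def)

text \<open>A downward jump at \<open>s\<close> is witnessed by two rationals: a level \<open>q\<close> strictly between \<open>f s\<close> and
  the left limit, and a time \<open>r < s\<close> after which \<open>f\<close> stays above \<open>q\<close> until \<open>s\<close>. A later jump
  with the same pair would contradict \<open>f s < q\<close>, so the pairs distinguish the jumps.\<close>

lemma countable_down_jumps:
  assumes f: "cadlag f"
  shows "countable {s. 0 < s \<and> f s < left_lim 0 f s}" (is "countable ?J")
proof -
  have "\<exists>q r. q \<in> \<rat> \<and> r \<in> \<rat> \<and> r < s \<and> f s < q \<and> (\<forall>u. r < u \<and> u < s \<longrightarrow> q < f u)"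
    if "s \<in> ?J" for s
  proof -
    from that have s: "0 < s" "f s < left_lim 0 f s" by auto
    obtain q where q: "q \<in> \<rat>" "f s < q" "q < left_lim 0 f s" using Rats_dense_in_real[OF s(2)] by blast
    from order_tendstoD(1)[OF cadlag_left[OF f s(1)] q(3)]
    obtain b where b: "b < s" "\<And>u. b < u \<Longrightarrow> u < s \<Longrightarrow> q < f u"
      unfolding eventually_at_left_field by blast
    obtain r where "r \<in> \<rat>" "b < r" "r < s" using Rats_dense_in_real[OF b(1)] by blast
    with q b show ?thesis by (meson order.strict_trans)
  qed
  then obtain q r where qr: "\<And>s. s \<in> ?J \<Longrightarrow> q s \<in> \<rat> \<and> r s \<in> \<rat> \<and> r s < s \<and> f s < q s
      \<and> (\<forall>u. r s < u \<and> u < s \<longrightarrow> q s < f u)"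
    by metis
  have *: "s = s'" if "s \<in> ?J" "s' \<in> ?J" "q s = q s'" "r s = r s'" "s \<le> s'" for s s'
    using qr[OF that(1)] qr[OF that(2)] that by (cases "s = s'") force+
  have "inj_on (\<lambda>s. (q s, r s)) ?J"
    by (rule inj_onI) (metis * Pair_inject linorder_le_cases)
  moreover have "countable ((\<lambda>s. (q s, r s)) ` ?J)"
    by (rule countable_subset[of _ "\<rat> \<times> \<rat>"]) (use qr in \<open>auto simp: countable_rat\<close>)
  ultimately show ?thesis by (rule countable_image_inj_on[rotated])
qed

text \<open>Whether a continuous path \<open>g\<close> meets the region under a cadlag barrier \<open>f\<close> can be read off at
  countably many times, except that \<open>g\<close> may come arbitrarily close to the barrier from the left of
  a downward jump without meeting it. This can only happen if \<open>g\<close> equals the left limit of \<open>f\<close>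
  there, which \<open>no_touch\<close> excludes; for a Brownian path and a fixed barrier the exclusion holds
  almost surely. This lemma is the source of all measurability of hitting events below.\<close>

lemma ex_le_cadlag_iff_rational:
  assumes g: "continuous_on {0..} g" and f: "cadlag f" and r: "0 \<le> r"
    and no_touch: "\<And>s. 0 < s \<Longrightarrow> f s < left_lim 0 f s \<Longrightarrow> g s \<noteq> left_lim 0 f s"
  shows "(\<exists>s. 0 \<le> s \<and> s \<le> r \<and> g s \<le> f s) \<longleftrightarrow>
         (\<forall>n. \<exists>q\<in>insert r (\<rat> \<inter> {0..r}). g q - f q < 1 / Suc n)"
proof
  assume "\<exists>s. 0 \<le> s \<and> s \<le> r \<and> g s \<le> f s"
  then obtain s where s: "0 \<le> s" "s \<le> r" "g s \<le> f s" by blast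
  show "\<forall>n. \<exists>q\<in>insert r (\<rat> \<inter> {0..r}). g q - f q < 1 / Suc n"
  proof (rule allI, cases "s = r")
    case True
    then show "\<exists>q\<in>insert r (\<rat> \<inter> {0..r}). g q - f q < 1 / Suc n" for n
      using s by (intro bexI[of _ r]) (auto intro: le_less_trans[of _ 0])
  next
    case False
    fix n
    have "(g \<longlongrightarrow> g s) (at_right s)"
      by (rule tendsto_within_subset[of _ _ _ "{0..}"]) (use g s(1) in \<open>auto simp: continuous_on_def\<close>)
    then have "((\<lambda>u. g u - f u) \<longlongrightarrow> g s - f s) (at_right s)"
      using cadlag_right[OF f s(1)] by (intro tendsto_diff)
    moreover have "g s - f s < 1 / Suc n"
      using s(3) by (auto intro: le_less_trans[of _ 0])
    ultimately have "eventually (\<lambda>u. g u - f u < 1 / Suc n) (at_right s)"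
      by (rule order_tendstoD(2))
    then obtain b where b: "b > s" "\<And>u. s < u \<Longrightarrow> u < b \<Longrightarrow> g u - f u < 1 / Suc n"
      unfolding eventually_at_right_field by blast
    from False s b obtain q where "q \<in> \<rat>" "s < q" "q < min b r"
      using Rats_dense_in_real[of s "min b r"] by auto
    with b s show "\<exists>q\<in>insert r (\<rat> \<inter> {0..r}). g q - f q < 1 / Suc n"
      by (intro bexI[of _ q]) auto
  qed
next
  assume R: "\<forall>n. \<exists>q\<in>insert r (\<rat> \<inter> {0..r}). g q - f q < 1 / Suc n"
  show "\<exists>s. 0 \<le> s \<and> s \<le> r \<and> g s \<le> f s"
  proof (rule ccontr)
    assume "\<not> ?thesis"
    then have pos: "f s < g s" if "0 \<le> s" "s \<le> r" for s
      using that by force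
    \<comment> \<open>A local positive gap between \<open>g\<close> and \<open>f\<close> extends to the compact interval \<open>[0, r]\<close> by bisection.\<close>
    define P where "P a b \<longleftrightarrow> (\<exists>e>0. \<forall>q. a \<le> q \<and> q \<le> b \<and> 0 \<le> q \<and> q \<le> r \<longrightarrow> e \<le> g q - f q)" for a b
    have "P 0 r"
    proof (rule Bolzano[OF r])
      fix a b c assume "P a b" "P b c"
      then obtain e e' where "e > 0" "e' > 0"
        "\<forall>q. a \<le> q \<and> q \<le> b \<and> 0 \<le> q \<and> q \<le> r \<longrightarrow> e \<le> g q - f q"
        "\<forall>q. b \<le> q \<and> q \<le> c \<and> 0 \<le> q \<and> q \<le> r \<longrightarrow> e' \<le> g q - f q"
        unfolding P_def by blast
      then show "P a c" unfolding P_def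
        by (intro exI[of _ "min e e'"]) (meson linorder_le_cases min.coboundedI1 min.coboundedI2 min_less_iff_conj)
    next
      fix x assume x: "0 \<le> x" "x \<le> r"
      have gx: "(g \<longlongrightarrow> g x) (at x within {0..})"
        using g x(1) by (simp add: continuous_on_def)
      have gr: "(g \<longlongrightarrow> g x) (at_right x)"
        by (rule tendsto_within_subset[OF gx]) (use x in auto)
      have lim: "((\<lambda>u. g u - f u) \<longlongrightarrow> g x - f x) (at_right x)"
        using cadlag_right[OF f x(1)] gr by (intro tendsto_diff)
      have half: "(g x - f x) / 2 < g x - f x" "0 < (g x - f x)/2" using pos[OF x] by auto
      from order_tendstoD(1)[OF lim half(1)]
      obtain b where b: "b > x" "\<And>u. x < u \<Longrightarrow> u < b \<Longrightarrow> (g x - f x) / 2 < g u - f u"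
        unfolding eventually_at_right_field by blast
      obtain a e where a: "a < x" "e > 0" "\<And>u. a < u \<Longrightarrow> u < x \<Longrightarrow> 0 \<le> u \<Longrightarrow> e < g u - f u"
      proof (cases "x = 0")
        case True
        then show ?thesis using that[of "-1" 1] by auto
      next
        case False
        with x have x0: "0 < x" by simp
        let ?l = "left_lim 0 f x"
        have gl: "(g \<longlongrightarrow> g x) (at_left x)"
          unfolding at_within_Icc_at_left[OF x0, symmetric]
          by (rule tendsto_within_subset[OF gx]) auto
        have lim: "((\<lambda>u. g u - f u) \<longlongrightarrow> g x - ?l) (at_left x)"
          by (intro tendsto_diff gl cadlag_left f x0)
        have "eventually (\<lambda>u. 0 < u) (at_left x)"
          using x0 by (auto simp: eventually_at_left_field intro!: exI[of _ 0])
        moreover have "eventually (\<lambda>u. u < x) (at_left x)"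
          by (auto simp: eventually_at_left_field intro!: exI[of _ "x - 1"])
        ultimately have "eventually (\<lambda>u. 0 \<le> g u - f u) (at_left x)"
          by eventually_elim (use pos x in \<open>force intro: less_imp_le\<close>)
        then have "0 \<le> g x - ?l"
          by (intro tendsto_lowerbound[OF lim]) auto
        then have "0 < g x - ?l"
          using no_touch[OF x0] pos[OF x] by (cases "f x < ?l") auto
        then have "0 < (g x - ?l) / 2" "(g x - ?l) / 2 < g x - ?l" by auto
        moreover from order_tendstoD(1)[OF lim this(2)] obtain a where
          "a < x" "\<And>u. a < u \<Longrightarrow> u < x \<Longrightarrow> (g x - ?l) / 2 < g u - f u"
          unfolding eventually_at_left_field by blast
        ultimately show ?thesis using that by blast
      qed
      define d where "d = min (x - a) (b - x)"
      have "P u v" if "u \<le> x \<and> x \<le> v \<and> v - u < d" for u v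
        unfolding P_def
      proof (intro exI[of _ "min e ((g x - f x)/2)"] conjI allI impI)
        fix q assume q: "u \<le> q \<and> q \<le> v \<and> 0 \<le> q \<and> q \<le> r"
        with that have "a < q" "q < b" by (auto simp: d_def)
        then show "min e ((g x - f x)/2) \<le> g q - f q"
          using a(3)[of q] b(2)[of q] q half by (cases q x rule: linorder_cases) (auto simp: min_def split: if_splits)
      qed (use a half in auto)
      moreover have "d > 0" using a b by (simp add: d_def)
      ultimately show "\<exists>d>0. \<forall>a b. a \<le> x \<and> x \<le> b \<and> b - a < d \<longrightarrow> P a b" by blast
    qed
    then obtain e where e: "e > 0" "\<And>q. 0 \<le> q \<Longrightarrow> q \<le> r \<Longrightarrow> e \<le> g q - f q"
      unfolding P_def by blast
    obtain n where "1 / Suc n < e" using e(1) nat_approx_posE by blast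
    moreover from R obtain q where "q \<in> insert r (\<rat> \<inter> {0..r})" "g q - f q < 1 / Suc n" by blast
    ultimately show False using e(2)[of q] r by auto
  qed
qed

section \<open>Probabilities in the completion\<close>

lemma pred_completion_cong_AE:
  assumes "AE \<omega> in M. P \<omega> \<longleftrightarrow> Q \<omega>" "Measurable.pred (completion M) Q"
  shows "Measurable.pred (completion M) P"
proof -
  have "{\<omega> \<in> space (completion M). P \<omega>} \<in> sets (completion M)"
  proof (rule completion.in_sets_AE)
    show "{\<omega> \<in> space (completion M). Q \<omega>} \<in> sets (completion M)"
      using assms(2) by (simp only: pred_def)
    have "AE x in completion M. P x \<longleftrightarrow> Q x" by (rule AE_completion[OF assms(1)])
    then show "AE x in completion M. x \<in> {\<omega> \<in> space (completion M). Q \<omega>} \<longleftrightarrow> x \<in> {\<omega> \<in> space (completion M). P \<omega>}"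
      by eventually_elim auto
  qed auto
  then show ?thesis by (simp only: pred_def)
qed

lemma prob_of_cong_AE:
  assumes "AE \<omega> in M. P \<omega> \<longleftrightarrow> Q \<omega>"
  shows "prob_of M P = prob_of M Q"
proof (cases "Measurable.pred (completion M) Q")
  case True
  then have "Measurable.pred (completion M) P" using assms by (rule pred_completion_cong_AE[rotated])
  with True show ?thesis unfolding prob_of_def pred_def
    using AE_completion[OF assms] by (intro measure_eq_AE) (auto elim: eventually_mono)
next
  case False
  have "AE \<omega> in M. Q \<omega> \<longleftrightarrow> P \<omega>" using assms by eventually_elim auto
  with False have "\<not> Measurable.pred (completion M) P" by (metis pred_completion_cong_AE)
  with False show ?thesis unfolding prob_of_def pred_def
    by (simp add: measure_notin_sets)
qed

context prob_space
begin

text \<open>Only the larger event needs to be measurable: the measure of a non-measurable set is \<open>0\<close>.\<close>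

lemma prob_of_mono_AE:
  assumes "AE \<omega> in M. P \<omega> \<longrightarrow> Q \<omega>" "Measurable.pred (completion M) Q"
  shows "prob_of M P \<le> prob_of M Q"
proof -
  interpret C: prob_space "completion M" by (rule prob_space_completion)
  show ?thesis unfolding prob_of_def
    using AE_completion[OF assms(1)] assms(2)
    by (intro C.finite_measure_mono_AE) (auto simp: pred_def elim: eventually_mono)
qed

lemma prob_of_eq_prob:
  assumes "Measurable.pred M P"
  shows "prob_of M P = \<P>(\<omega> in M. P \<omega>)"
  using assms by (simp add: prob_of_def pred_def)

lemma prob_of_disjoint_Un:
  assumes "Measurable.pred (completion M) P" "Measurable.pred (completion M) Q"
    and "\<And>\<omega>. \<not> (P \<omega> \<and> Q \<omega>)"
  shows "prob_of M (\<lambda>\<omega>. P \<omega> \<or> Q \<omega>) = prob_of M P + prob_of M Q"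
proof -
  interpret C: prob_space "completion M" by (rule prob_space_completion)
  have "{\<omega> \<in> space M. P \<omega> \<or> Q \<omega>} = {\<omega> \<in> space M. P \<omega>} \<union> {\<omega> \<in> space M. Q \<omega>}" by auto
  then show ?thesis unfolding prob_of_def
    using assms by (subst C.finite_measure_Union[symmetric]) (auto simp: pred_def)
qed

end

section \<open>Gaussian tails and a maximal inequality\<close>

text \<open>The function \<open>- s\<^sup>2 * normal_density 0 s x\<close> is an antiderivative of
  \<open>x * normal_density 0 s x\<close>. All Gaussian tail estimates below are multiples of the density at
  the cut-off point, so that they can be compared with each other without evaluating exponentials.\<close>

lemma normal_tail_moment:
  fixes a s :: real
  assumes "0 < s" "0 \<le> a"
  shows "(\<integral>\<^sup>+x. ennreal (x * normal_density 0 s x) * indicator {a..} x \<partial>lborel) = s\<^sup>2 * normal_density 0 s a"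
proof -
  have "(\<integral>\<^sup>+x. ennreal (x * normal_density 0 s x) * indicator {a..} x \<partial>lborel) =
      ennreal (0 - (- s\<^sup>2 * normal_density 0 s a))"
  proof (rule nn_integral_FTC_atLeast)
    show "((\<lambda>x. - s\<^sup>2 * normal_density 0 s x) has_real_derivative x * normal_density 0 s x) (at x)" for x
      unfolding normal_density_def using assms(1)
      by (auto intro!: derivative_eq_intros simp: field_simps power2_eq_square)
    have "((\<lambda>x. exp (- ((x - 0)\<^sup>2) / (2 * s\<^sup>2))) \<longlongrightarrow> 0) at_top"
      using assms(1) by (real_asymp)
    then have "((\<lambda>x. - s\<^sup>2 * (1 / sqrt (2 * pi * s\<^sup>2) * exp (- ((x - 0)\<^sup>2) / (2 * s\<^sup>2)))) \<longlongrightarrow> - s\<^sup>2 * (1 / sqrt (2 * pi * s\<^sup>2) * 0)) at_top"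
      by (intro tendsto_mult tendsto_const)
    then show "((\<lambda>x. - s\<^sup>2 * normal_density 0 s x) \<longlongrightarrow> 0) at_top"
      by (simp add: normal_density_def)
  qed (use assms in auto)
  then show ?thesis by simp
qed

lemma normal_density_antimono:
  assumes "0 \<le> x" "x \<le> y"
  shows "normal_density 0 s y \<le> normal_density 0 s x"
  using assms unfolding normal_density_def
  by (intro mult_left_mono iffD2[OF exp_le_cancel_iff] divide_right_mono) (auto intro!: power_mono)

context prob_space
begin

lemma normal_tail_expectation:
  assumes G: "distributed M lborel G (normal_density 0 s)" and "0 < s" "0 \<le> a"
  shows "integrable M (\<lambda>\<omega>. G \<omega> * indicator {a..} (G \<omega>))"
    "expectation (\<lambda>\<omega>. G \<omega> * indicator {a..} (G \<omega>)) = s\<^sup>2 * normal_density 0 s a"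
proof -
  have [measurable]: "G \<in> borel_measurable M"
    using distributed_measurable[OF G] by simp
  have nn: "0 \<le> G \<omega> * indicator {a..} (G \<omega>)" for \<omega>
    using assms(3) by (auto simp: indicator_def)
  have "(\<integral>\<^sup>+\<omega>. ennreal (G \<omega> * indicator {a..} (G \<omega>)) \<partial>M) =
      (\<integral>\<^sup>+x. ennreal (normal_density 0 s x) * ennreal (x * indicator {a..} x) \<partial>lborel)"
    by (rule distributed_nn_integral[OF G, symmetric]) measurable
  also have "\<dots> = (\<integral>\<^sup>+x. ennreal (x * normal_density 0 s x) * indicator {a..} x \<partial>lborel)"
    by (intro nn_integral_cong) (auto simp: indicator_def ennreal_mult''[symmetric] mult.commute)
  also have "\<dots> = ennreal (s\<^sup>2 * normal_density 0 s a)"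
    using normal_tail_moment[OF assms(2,3)] .
  finally have *: "(\<integral>\<^sup>+\<omega>. ennreal (G \<omega> * indicator {a..} (G \<omega>)) \<partial>M) = ennreal (s\<^sup>2 * normal_density 0 s a)" .
  then show "integrable M (\<lambda>\<omega>. G \<omega> * indicator {a..} (G \<omega>))"
    by (intro integrableI_nonneg) (use nn in auto)
  from * show "expectation (\<lambda>\<omega>. G \<omega> * indicator {a..} (G \<omega>)) = s\<^sup>2 * normal_density 0 s a"
    using nn by (subst integral_eq_nn_integral) auto
qed

lemma normal_tail_upper:
  assumes G: "distributed M lborel G (normal_density 0 s)" and "0 < s" "0 < a"
  shows "\<P>(\<omega> in M. a \<le> G \<omega>) \<le> s\<^sup>2 * normal_density 0 s a / a"
proof -
  have [measurable]: "G \<in> borel_measurable M"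
    using distributed_measurable[OF G] by simp
  have "a * \<P>(\<omega> in M. a \<le> G \<omega>) = expectation (\<lambda>\<omega>. a * indicator {\<omega> \<in> space M. a \<le> G \<omega>} \<omega>)"
    by simp
  also have "\<dots> \<le> expectation (\<lambda>\<omega>. G \<omega> * indicator {a..} (G \<omega>))"
  proof (rule integral_mono)
    show "integrable M (\<lambda>\<omega>. a * indicator {\<omega> \<in> space M. a \<le> G \<omega>} \<omega>)"
      by (intro integrable_mult_right integrable_real_indicator) (auto simp: emeasure_eq_measure)
    show "integrable M (\<lambda>\<omega>. G \<omega> * indicator {a..} (G \<omega>))"
      using assms(3) by (intro normal_tail_expectation(1)[OF assms(1,2)]) auto
  qed (auto simp: indicator_def)
  also have "\<dots> = s\<^sup>2 * normal_density 0 s a"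
    using assms(3) by (intro normal_tail_expectation(2)[OF assms(1,2)]) auto
  finally show ?thesis using assms(3) by (simp add: field_simps)
qed

lemma normal_tail_lower:
  assumes G: "distributed M lborel G (normal_density 0 s)" and "0 \<le> c" "0 \<le> d"
  shows "d * normal_density 0 s (c + d) \<le> \<P>(\<omega> in M. c \<le> G \<omega>)"
proof -
  have "ennreal (d * normal_density 0 s (c + d)) = (\<integral>\<^sup>+x. ennreal (normal_density 0 s (c + d)) * indicator {c..c+d} x \<partial>lborel)"
    using assms by (subst nn_integral_cmult_indicator) (auto simp: ennreal_mult' mult.commute)
  also have "\<dots> \<le> (\<integral>\<^sup>+x. ennreal (normal_density 0 s x) * indicator {c..} x \<partial>lborel)"
    using assms by (intro nn_integral_mono) (auto simp: indicator_def intro!: normal_density_antimono)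
  also have "\<dots> = emeasure M (G -` {c..} \<inter> space M)"
    by (rule distributed_emeasure[OF G, symmetric]) auto
  also have "G -` {c..} \<inter> space M = {\<omega> \<in> space M. c \<le> G \<omega>}" by auto
  finally show ?thesis by (simp add: emeasure_eq_measure)
qed

lemma normal_uminus:
  assumes "distributed M lborel G (normal_density 0 s)" "0 < s"
  shows "distributed M lborel (\<lambda>\<omega>. - G \<omega>) (normal_density 0 s)"
  using normal_density_affine[OF assms, of "-1" 0] by simp

lemma normal_nonneg_half:
  assumes G: "distributed M lborel G (normal_density 0 s)" and "0 < s"
  shows "1 / 2 \<le> \<P>(\<omega> in M. 0 \<le> G \<omega>)"
proof -
  have [measurable]: "G \<in> borel_measurable M"
    using distributed_measurable[OF G] by simp
  let ?I = "\<integral>\<^sup>+x. ennreal (normal_density 0 s x) * indicator {0..} x \<partial>lborel"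
  have "emeasure M (G -` {0..} \<inter> space M) = ?I" "emeasure M ((\<lambda>\<omega>. - G \<omega>) -` {0..} \<inter> space M) = ?I"
    using distributed_emeasure[OF G, of "{0..}"] distributed_emeasure[OF normal_uminus[OF assms], of "{0..}"] by auto
  then have "prob (G -` {0..} \<inter> space M) = prob ((\<lambda>\<omega>. - G \<omega>) -` {0..} \<inter> space M)"
    by (simp add: measure_def)
  moreover have "1 = prob (G -` {0..} \<inter> space M \<union> (\<lambda>\<omega>. - G \<omega>) -` {0..} \<inter> space M)"
    by (subst prob_space[symmetric], rule arg_cong[where f=prob]) auto
  moreover have "\<dots> \<le> prob (G -` {0..} \<inter> space M) + prob ((\<lambda>\<omega>. - G \<omega>) -` {0..} \<inter> space M)"
    by (rule measure_Un_le) auto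
  moreover have "G -` {0..} \<inter> space M = {\<omega> \<in> space M. 0 \<le> G \<omega>}" by auto
  ultimately show ?thesis by simp
qed

text \<open>Levy's inequality. Split according to the first index \<open>k\<close> at which the partial sum reaches
  \<open>a\<close>; the remaining sum is independent of that event and is non-negative with probability at
  least one half, in which case the full sum is at least \<open>a\<close> too.\<close>

lemma levy_maximal:
  fixes X :: "nat \<Rightarrow> 'a \<Rightarrow> real" and n :: nat
  assumes ind: "indep_vars (\<lambda>_. borel) X {..<n}"
    and half: "\<And>k. k \<le> n \<Longrightarrow> 1 / 2 \<le> \<P>(\<omega> in M. 0 \<le> (\<Sum>i\<in>{k..<n}. X i \<omega>))"
  shows "\<P>(\<omega> in M. \<exists>k\<le>n. a \<le> (\<Sum>i<k. X i \<omega>)) \<le> 2 * \<P>(\<omega> in M. a \<le> (\<Sum>i<n. X i \<omega>))"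
proof -
  have X: "X i \<in> borel_measurable M" if "i < n" for i
    using ind that by (auto simp: indep_vars_def)
  have S[measurable]: "(\<lambda>\<omega>. \<Sum>i<k. X i \<omega>) \<in> borel_measurable M" if "k \<le> n" for k
    using X that by (intro borel_measurable_sum) auto
  have T[measurable]: "(\<lambda>\<omega>. \<Sum>i\<in>{k..<n}. X i \<omega>) \<in> borel_measurable M" for k
    using X by (intro borel_measurable_sum) auto
  define A where "A k = {\<omega> \<in> space M. a \<le> (\<Sum>i<k. X i \<omega>) \<and> (\<forall>j<k. \<not> a \<le> (\<Sum>i<j. X i \<omega>))}" for k
  define R where "R k = {\<omega> \<in> space M. 0 \<le> (\<Sum>i\<in>{k..<n}. X i \<omega>)}" for k
  have A[measurable]: "A k \<in> events" if "k \<le> n" for k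
    unfolding A_def using that
    by (intro sets.sets_Collect_conj sets.sets_Collect_finite_All' sets.sets_Collect_neg) 
       (auto intro!: borel_measurable_le S)
  have R[measurable]: "R k \<in> events" for k
    unfolding R_def by measurable
  have disj: "disjoint_family_on A {..n}"
    unfolding disjoint_family_on_def A_def by (auto; metis linorder_neqE_nat)
  have indAR: "prob (A k \<inter> R k) = prob (A k) * prob (R k)" if k: "k \<le> n" for k
  proof -
    let ?P = "\<lambda>I. PiM I (\<lambda>_. borel :: real measure)"
    define UA where "UA = {x \<in> space (?P {..<k}). a \<le> (\<Sum>i<k. x i) \<and> (\<forall>j<k. \<not> a \<le> (\<Sum>i<j. x i))}"
    define UR where "UR = {x \<in> space (?P {k..<n}). 0 \<le> (\<Sum>i\<in>{k..<n}. x i)}"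
    have iv: "indep_var (?P {..<k}) (\<lambda>\<omega>. restrict (\<lambda>i. X i \<omega>) {..<k}) (?P {k..<n}) (\<lambda>\<omega>. restrict (\<lambda>i. X i \<omega>) {k..<n})"
      using k by (intro indep_var_restrict[OF ind]) auto
    have m: "(\<lambda>x. \<Sum>i<j. x i) \<in> borel_measurable (?P {..<k})" if "j \<le> k" for j
      using that by (intro borel_measurable_sum measurable_component_singleton) auto
    have UA: "UA \<in> sets (?P {..<k})"
      unfolding UA_def
      by (intro sets.sets_Collect_conj sets.sets_Collect_finite_All' sets.sets_Collect_neg)
         (auto intro!: borel_measurable_le m)
    have UR: "UR \<in> sets (?P {k..<n})"
      unfolding UR_def by (auto intro!: borel_measurable_le borel_measurable_sum measurable_component_singleton)
    have "(\<Sum>i<j. (\<lambda>i\<in>{..<k}. X i \<omega>) i) = (\<Sum>i<j. X i \<omega>)" if "j \<le> k" for j \<omega>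
      using that by (intro sum.cong) auto
    then have eA: "A k = (\<lambda>\<omega>. restrict (\<lambda>i. X i \<omega>) {..<k}) -` UA \<inter> space M"
      unfolding A_def UA_def by (auto simp: space_PiM PiE_def)
    have eR: "R k = (\<lambda>\<omega>. restrict (\<lambda>i. X i \<omega>) {k..<n}) -` UR \<inter> space M"
      unfolding R_def UR_def by (auto simp: space_PiM PiE_def)
    have "(\<lambda>\<omega>. (restrict (\<lambda>i. X i \<omega>) {..<k}, restrict (\<lambda>i. X i \<omega>) {k..<n})) -` (UA \<times> UR) \<inter> space M = A k \<inter> R k"
      unfolding eA eR by auto
    with indep_varD[OF iv UA UR] show ?thesis by (simp add: eA eR)
  qed
  have "{\<omega> \<in> space M. \<exists>k\<le>n. a \<le> (\<Sum>i<k. X i \<omega>)} = (\<Union>k\<in>{..n}. A k)"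
  proof (intro equalityI subsetI)
    fix \<omega> assume "\<omega> \<in> {\<omega> \<in> space M. \<exists>k\<le>n. a \<le> (\<Sum>i<k. X i \<omega>)}"
    then obtain k where k: "\<omega> \<in> space M" "k \<le> n" "a \<le> (\<Sum>i<k. X i \<omega>)" by auto
    define m where "m = (LEAST k. a \<le> (\<Sum>i<k. X i \<omega>))"
    have "a \<le> (\<Sum>i<m. X i \<omega>)" "m \<le> k" "\<forall>j<m. \<not> a \<le> (\<Sum>i<j. X i \<omega>)"
      unfolding m_def using k(3) by (auto intro: LeastI Least_le dest: not_less_Least)
    with k show "\<omega> \<in> (\<Union>k\<in>{..n}. A k)" unfolding A_def by (auto intro!: bexI[of _ m])
  qed (auto simp: A_def)
  then have "\<P>(\<omega> in M. \<exists>k\<le>n. a \<le> (\<Sum>i<k. X i \<omega>)) = (\<Sum>k\<le>n. prob (A k))"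
    using disj by (simp add: finite_measure_finite_Union A image_subset_iff)
  also have "\<dots> \<le> (\<Sum>k\<le>n. 2 * prob (A k \<inter> R k))"
  proof (intro sum_mono)
    fix k assume "k \<in> {..n}"
    then have k: "k \<le> n" by simp
    have "prob (A k) * (1 / 2) \<le> prob (A k) * prob (R k)"
      using half[OF k] by (intro mult_left_mono) (auto simp: R_def)
    then show "prob (A k) \<le> 2 * prob (A k \<inter> R k)" using indAR[OF k] by simp
  qed
  also have "\<dots> = 2 * prob (\<Union>k\<in>{..n}. A k \<inter> R k)"
    using disj
    by (subst finite_measure_finite_Union) (auto simp: sum_distrib_left disjoint_family_on_def A R image_subset_iff)
  also have "\<dots> \<le> 2 * \<P>(\<omega> in M. a \<le> (\<Sum>i<n. X i \<omega>))"
  proof (intro mult_left_mono finite_measure_mono subsetI)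
    fix \<omega> assume "\<omega> \<in> (\<Union>k\<in>{..n}. A k \<inter> R k)"
    then obtain k where k: "k \<le> n" "\<omega> \<in> A k" "\<omega> \<in> R k" by auto
    have "(\<Sum>i<n. X i \<omega>) = (\<Sum>i<k. X i \<omega>) + (\<Sum>i\<in>{k..<n}. X i \<omega>)"
      using k(1) by (metis atLeast0LessThan le0 sum.atLeastLessThan_concat)
    with k show "\<omega> \<in> {\<omega> \<in> space M. a \<le> (\<Sum>i<n. X i \<omega>)}" by (auto simp: A_def R_def)
  qed (auto intro!: borel_measurable_le S)
  finally show ?thesis .
qed

end

context prob_space
begin

lemma brownian_measurable:
  assumes "standard_brownian_motion M B" "0 \<le> t"
  shows "B t \<in> borel_measurable M"
  using assms by (simp add: standard_brownian_motion_def)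

lemma brownian_increment_normal:
  assumes "standard_brownian_motion M B" "0 \<le> s" "s < t"
  shows "distributed M lborel (\<lambda>\<omega>. B t \<omega> - B s \<omega>) (normal_density 0 (sqrt (t - s)))"
  using assms by (simp add: standard_brownian_motion_def)

text \<open>The increments over a uniform grid are independent and symmetric, so the discrete inequality
  applies.\<close>

lemma brownian_grid_maximal:
  assumes BM: "standard_brownian_motion M B" and t: "0 \<le> t" and h: "0 < h" and N: "0 < (N::nat)"
  shows "\<P>(\<omega> in M. \<exists>k\<le>N. b \<le> B (t + real k * h / real N) \<omega> - B t \<omega>) \<le> 2 * \<P>(\<omega> in M. b \<le> B (t + h) \<omega> - B t \<omega>)"
proof -
  define u where "u k = t + real k * h / real N" for k
  define X where "X i \<omega> = B (u (Suc i)) \<omega> - B (u i) \<omega>" for i \<omega>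
  have mono: "u i \<le> u j" if "i \<le> j" for i j
    using that h by (auto simp: u_def intro!: divide_right_mono mult_right_mono)
  have u0: "u 0 = t" and uN: "u N = t + h" using N by (auto simp: u_def)
  have tel: "(\<Sum>i<k. X i \<omega>) = B (u k) \<omega> - B t \<omega>" for k \<omega>
    using sum_lessThan_telescope[of "\<lambda>i. B (u i) \<omega>" k] by (simp add: X_def u0)
  have "\<P>(\<omega> in M. \<exists>k\<le>N. b \<le> (\<Sum>i<k. X i \<omega>)) \<le> 2 * \<P>(\<omega> in M. b \<le> (\<Sum>i<N. X i \<omega>))"
  proof (rule levy_maximal)
    have *: "0 \<le> u 0 \<and> (\<forall>i<N. u i \<le> u (Suc i))" using t mono by (auto simp: u0)
    show "indep_vars (\<lambda>_. borel) X {..<N}"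
      using BM[unfolded standard_brownian_motion_def, THEN conjunct2, THEN conjunct2, THEN conjunct1,
        rule_format, OF *] by (simp add: X_def[abs_def])
    fix k assume k: "k \<le> N"
    have tel2: "(\<Sum>i\<in>{k..<N}. X i \<omega>) = B (t + h) \<omega> - B (u k) \<omega>" for \<omega>
      using sum_Suc_diff'[OF k, of "\<lambda>i. B (u i) \<omega>"] by (simp add: X_def uN)
    show "1 / 2 \<le> \<P>(\<omega> in M. 0 \<le> (\<Sum>i\<in>{k..<N}. X i \<omega>))"
    proof (cases "u k = t + h")
      case True
      then show ?thesis by (simp add: tel2 prob_space)
    next
      case False
      then have "0 \<le> u k" "u k < t + h" using mono[OF k] mono[of 0 k] t u0 uN by auto
      from normal_nonneg_half[OF brownian_increment_normal[OF BM this]] this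
      show ?thesis by (simp add: tel2)
    qed
  qed
  then show ?thesis unfolding tel uN by (simp add: u_def)
qed

text \<open>Passage from grids to continuous time: the dyadic grids are nested, and a continuous path
  that reaches \<open>a\<close> exceeds the smaller level \<open>b\<close> at some dyadic time.\<close>

lemma brownian_maximal_AE:
  assumes BM: "standard_brownian_motion M B" and t: "0 \<le> t" and h: "0 < h" and ba: "b < a"
    and P: "AE \<omega> in M. P \<omega> \<longrightarrow> (\<exists>s. t \<le> s \<and> s \<le> t + h \<and> a \<le> B s \<omega> - B t \<omega>)"
  shows "prob_of M P \<le> 2 * \<P>(\<omega> in M. b \<le> B (t + h) \<omega> - B t \<omega>)"
proof -
  define E where "E n = {\<omega> \<in> space M. \<exists>k\<in>{..2^n}. b \<le> B (t + real k * h / real (2^n)) \<omega> - B t \<omega>}" for n :: nat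
  have E[measurable]: "E n \<in> events" for n
    unfolding E_def
    by (intro sets.sets_Collect_finite_Ex borel_measurable_le borel_measurable_diff borel_measurable_const
          brownian_measurable[OF BM]) (use t h in auto)
  have "incseq E"
  proof (rule incseq_SucI, rule subsetI)
    fix n \<omega> assume "\<omega> \<in> E n"
    then obtain k where "\<omega> \<in> space M" "k \<le> 2^n" "b \<le> B (t + real k * h / real (2^n)) \<omega> - B t \<omega>"
      by (auto simp: E_def)
    moreover have "real (2 * k) * h / real (2 ^ Suc n) = real k * h / real (2^n)" by simp
    ultimately show "\<omega> \<in> E (Suc n)" unfolding E_def
      by (intro CollectI conjI bexI[of _ "2 * k"]) (simp_all del: of_nat_mult)
  qed
  have le: "prob (E n) \<le> 2 * \<P>(\<omega> in M. b \<le> B (t + h) \<omega> - B t \<omega>)" for n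
    using brownian_grid_maximal[OF BM t h, of "2^n" b] by (simp add: E_def atMost_def Bex_def)
  have "(\<lambda>n. prob (E n)) \<longlonglongrightarrow> prob (\<Union>n. E n)"
    using \<open>incseq E\<close> by (intro finite_Lim_measure_incseq) auto
  then have U: "prob (\<Union>n. E n) \<le> 2 * \<P>(\<omega> in M. b \<le> B (t + h) \<omega> - B t \<omega>)"
    by (rule LIMSEQ_le_const2) (use le in auto)
  have cont: "AE \<omega> in M. continuous_on {0..} (\<lambda>t. B t \<omega>)"
    using BM by (simp add: standard_brownian_motion_def)
  have hit: "\<exists>n. \<omega> \<in> E n" if "\<omega> \<in> space M" "continuous_on {0..} (\<lambda>t. B t \<omega>)" "t \<le> s" "s \<le> t + h" "a \<le> B s \<omega> - B t \<omega>" for \<omega> s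
  proof -
    have "s \<in> {0..}" using that t by auto
    from that(2)[unfolded continuous_on_iff, rule_format, OF this, of "a - b"] ba
    obtain d where d: "d > 0" "\<And>x. x \<ge> 0 \<Longrightarrow> \<bar>x - s\<bar> < d \<Longrightarrow> \<bar>B x \<omega> - B s \<omega>\<bar> < a - b"
      by (auto simp: dist_real_def)
    obtain n where n: "h / d < 2 ^ n" using real_arch_pow[of 2 "h / d"] by auto
    then have n': "h / 2^n < d" using d(1) by (simp add: field_simps)
    define k where "k = nat \<lfloor>(s - t) / h * 2 ^ n\<rfloor>"
    have nn: "0 \<le> (s - t) / h * 2 ^ n" using that h by auto
    then have k1: "real k \<le> (s - t) / h * 2 ^ n" "(s - t) / h * 2 ^ n < real k + 1"
      unfolding k_def by linarith+
    have "(s - t) / h \<le> 1" using that h by simp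
    then have "(s - t) / h * 2 ^ n \<le> 1 * 2^n" by (intro mult_right_mono) auto
    with k1(1) have "real k \<le> 2^n" by linarith
    then have k2: "k \<le> 2^n" by (metis of_nat_le_iff of_nat_numeral of_nat_power)
    have "real k * h / 2^n \<le> s - t" "s - t < real k * h / 2^n + h / 2^n"
      using k1 h by (simp_all add: field_simps)
    then have "\<bar>B (t + real k * h / 2^n) \<omega> - B s \<omega>\<bar> < a - b"
      using n' t h by (intro d(2)) auto
    with that k2 show ?thesis by (intro exI[of _ n]) (auto simp: E_def intro!: bexI[of _ k])
  qed
  have "prob_of M P \<le> prob_of M (\<lambda>\<omega>. \<omega> \<in> (\<Union>n. E n))"
  proof (rule prob_of_mono_AE)
    show "AE \<omega> in M. P \<omega> \<longrightarrow> \<omega> \<in> (\<Union>n. E n)"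
      using cont P AE_space by eventually_elim (auto dest: hit)
    show "Measurable.pred (completion M) (\<lambda>\<omega>. \<omega> \<in> (\<Union>n. E n))"
      by (intro measurable_completion) measurable
  qed
  also have "\<dots> = \<P>(\<omega> in M. \<omega> \<in> (\<Union>n. E n))"
    by (rule prob_of_eq_prob) measurable
  also have "{\<omega> \<in> space M. \<omega> \<in> (\<Union>n. E n)} = (\<Union>n. E n)" by (auto simp: E_def)
  finally show ?thesis using U by simp
qed

end

section \<open>Independence of the past from future increments\<close>

definition cylinder_sets :: "'a measure \<Rightarrow> (real \<Rightarrow> 'a \<Rightarrow> real) \<Rightarrow> real set \<Rightarrow> 'a set set" where
  "cylinder_sets M B I =
     sigma_sets (space M) (\<Union>s\<in>I. {(\<lambda>\<omega>. B s \<omega> - B 0 \<omega>) -` A \<inter> space M | A. A \<in> sets borel})"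

text \<open>The sets \<open>{Z \<in> A} \<inter> C\<close> form an intersection-stable generator of the information about \<open>Z\<close> and
  the path up to time \<open>t\<close>. Increments from time \<open>0\<close> replace the values of \<open>B\<close>, because only
  increments are controlled everywhere; \<open>B 0\<close> vanishes merely almost surely.\<close>

definition past_generator :: "'a measure \<Rightarrow> ('a \<Rightarrow> real) \<Rightarrow> (real \<Rightarrow> 'a \<Rightarrow> real) \<Rightarrow> real \<Rightarrow> 'a set set" where
  "past_generator M Z B t = {Z -` A \<inter> C | A C. A \<in> sets borel \<and>
     (\<exists>I. finite I \<and> I \<subseteq> {0..t} \<and> C \<in> cylinder_sets M B I)}"

definition past :: "'a measure \<Rightarrow> ('a \<Rightarrow> real) \<Rightarrow> (real \<Rightarrow> 'a \<Rightarrow> real) \<Rightarrow> real \<Rightarrow> 'a measure" where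
  "past M Z B t = sigma (space M) (past_generator M Z B t)"

lemma cylinder_sets_into_space: "C \<in> cylinder_sets M B I \<Longrightarrow> C \<subseteq> space M"
  unfolding cylinder_sets_def by (rule sigma_sets_into_sp) auto

lemma past_generator_into_space: "past_generator M Z B t \<subseteq> Pow (space M)"
  using cylinder_sets_into_space by (fastforce simp: past_generator_def)

lemma space_past: "space (past M Z B t) = space M"
  by (simp add: past_def space_measure_of_conv)

lemma sets_past: "sets (past M Z B t) = sigma_sets (space M) (past_generator M Z B t)"
  unfolding past_def by (rule sets_measure_of[OF past_generator_into_space])

lemma space_in_cylinder_sets: "space M \<in> cylinder_sets M B I"
  unfolding cylinder_sets_def by (rule sigma_sets_top)

lemma cylinder_sets_mono: "I \<subseteq> J \<Longrightarrow> cylinder_sets M B I \<subseteq> cylinder_sets M B J"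
  unfolding cylinder_sets_def by (rule sigma_sets_mono') auto

lemma cylinder_sets_Int:
  assumes "C \<in> cylinder_sets M B I" "D \<in> cylinder_sets M B I"
  shows "C \<inter> D \<in> cylinder_sets M B I"
proof -
  interpret sigma_algebra "space M" "cylinder_sets M B I"
    unfolding cylinder_sets_def by (rule sigma_algebra_sigma_sets) auto
  show ?thesis using assms by (rule Int)
qed

lemma cylinder_sets_subset:
  assumes "\<And>s. s \<in> I \<Longrightarrow> (\<lambda>\<omega>. B s \<omega> - B 0 \<omega>) \<in> borel_measurable F" "space F = space M"
  shows "cylinder_sets M B I \<subseteq> sets F"
  unfolding cylinder_sets_def assms(2)[symmetric]
  by (rule sets.sigma_sets_subset) (use assms(1) in \<open>auto intro: measurable_sets\<close>)

lemma measurable_past_initial: "Z \<in> borel_measurable (past M Z B t)"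
proof (rule measurableI)
  fix A :: "real set" assume "A \<in> sets borel"
  then have "Z -` A \<inter> space M \<in> past_generator M Z B t"
    using space_in_cylinder_sets[of M B "{}"] by (auto simp: past_generator_def)
  then show "Z -` A \<inter> space (past M Z B t) \<in> sets (past M Z B t)"
    by (auto simp: space_past sets_past)
qed simp

lemma measurable_past_increment:
  assumes "0 \<le> s" "s \<le> t"
  shows "(\<lambda>\<omega>. B s \<omega> - B 0 \<omega>) \<in> borel_measurable (past M Z B t)"
proof (rule measurableI)
  fix A :: "real set" assume "A \<in> sets borel"
  then have "(\<lambda>\<omega>. B s \<omega> - B 0 \<omega>) -` A \<inter> space M \<in> cylinder_sets M B {s}"
    unfolding cylinder_sets_def by (intro sigma_sets.Basic) auto
  then have "Z -` UNIV \<inter> ((\<lambda>\<omega>. B s \<omega> - B 0 \<omega>) -` A \<inter> space M) \<in> past_generator M Z B t"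
    unfolding past_generator_def using assms 
    by (intro CollectI exI conjI refl[of "_ \<inter> _"] exI[of _ "{s}"]) auto
  then show "(\<lambda>\<omega>. B s \<omega> - B 0 \<omega>) -` A \<inter> space (past M Z B t) \<in> sets (past M Z B t)"
    by (auto simp: space_past sets_past)
qed simp

context prob_space
begin

lemma cylinder_sets_events:
  assumes BM: "standard_brownian_motion M B" and I: "I \<subseteq> {0..}"
  shows "cylinder_sets M B I \<subseteq> events"
  by (rule cylinder_sets_subset) (use I in \<open>auto intro!: borel_measurable_diff brownian_measurable[OF BM]\<close>)

lemma past_generator_events:
  assumes BM: "standard_brownian_motion M B" and Z: "Z \<in> borel_measurable M"
  shows "past_generator M Z B t \<subseteq> events"
proof
  fix E assume "E \<in> past_generator M Z B t"
  then obtain A C I where E: "E = Z -` A \<inter> C" "A \<in> sets borel" "I \<subseteq> {0..t}" "C \<in> cylinder_sets M B I"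
    by (auto simp: past_generator_def)
  have "C \<in> events" using cylinder_sets_events[OF BM, of I] E by (fastforce dest: subsetD)
  moreover have "Z -` A \<inter> space M \<in> events" using Z E(2) by (rule measurable_sets)
  moreover have "E = (Z -` A \<inter> space M) \<inter> C" using E cylinder_sets_into_space by fastforce
  ultimately show "E \<in> events" by auto
qed

lemma past_measurable:
  assumes "standard_brownian_motion M B" and "Z \<in> borel_measurable M" and "R \<in> measurable (past M Z B t) N"
  shows "R \<in> measurable M N"
proof -
  have "sets (past M Z B t) \<subseteq> events"
    unfolding sets_past by (rule sets.sigma_sets_subset[OF past_generator_events[OF assms(1,2)]])
  then show ?thesis using assms(3) space_past[of M Z B t] by (auto simp: measurable_def)
qed

text \<open>Sort the finitely many times, together with \<open>0\<close> and \<open>t\<close>, and append \<open>u\<close>: the cylinder set is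
  then a function of all increments but the last one, and the last one is the increment from \<open>t\<close>
  to \<open>u\<close>.\<close>

lemma cylinder_indep_increment:
  assumes BM: "standard_brownian_motion M B" and t: "0 \<le> t" "t < u"
    and I: "finite I" "I \<subseteq> {0..t}" and C: "C \<in> cylinder_sets M B I" and H: "H \<in> sets borel"
  shows "prob (C \<inter> ((\<lambda>\<omega>. B u \<omega> - B t \<omega>) -` H \<inter> space M)) =
    prob C * prob ((\<lambda>\<omega>. B u \<omega> - B t \<omega>) -` H \<inter> space M)"
proof -
  define L where "L = sorted_list_of_set (insert 0 (insert t I))"
  define N where "N = length L"
  have setL: "set L = insert 0 (insert t I)" and sortL: "sorted L"
    using I unfolding L_def by (simp_all del: sorted_list_of_set_insert_remove)
  have N: "0 < N" using setL by (auto simp: N_def)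
  have L_range: "0 \<le> L ! i" "L ! i \<le> t" if "i < N" for i
  proof -
    have "L ! i \<in> insert 0 (insert t I)" using that nth_mem[of i L] setL by (simp add: N_def)
    then show "0 \<le> L ! i" "L ! i \<le> t" using I t by auto
  qed
  have L_mono: "L ! i \<le> L ! j" if "i \<le> j" "j < N" for i j
    using sortL that by (auto simp: N_def intro: sorted_nth_mono)
  obtain i0 where "i0 < N" "L ! i0 = 0" using setL by (metis N_def in_set_conv_nth insertI1)
  then have L0: "L ! 0 = 0" using L_mono[of 0 i0] L_range(1)[of 0] N by auto
  obtain i1 where "i1 < N" "L ! i1 = t" using setL by (metis N_def in_set_conv_nth insertI1 insertI2)
  then have LN: "L ! (N - 1) = t" using L_mono[of i1 "N - 1"] L_range(2)[of "N - 1"] N by auto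
  define v where "v i = (if i < N then L ! i else u)" for i
  define X where "X i \<omega> = B (v (Suc i)) \<omega> - B (v i) \<omega>" for i \<omega>
  have v: "0 \<le> v 0 \<and> (\<forall>i<N. v i \<le> v (Suc i))"
    using N L0 L_mono L_range t by (force simp: v_def)
  have ind: "indep_vars (\<lambda>_. borel) X {..<N}"
    using BM[unfolded standard_brownian_motion_def, THEN conjunct2, THEN conjunct2, THEN conjunct1,
        rule_format, OF v] by (simp add: X_def[abs_def])
  let ?P = "\<lambda>I. PiM I (\<lambda>_. borel :: real measure)"
  let ?V = "\<lambda>\<omega>. restrict (\<lambda>i. X i \<omega>) {..<N - 1}" and ?U = "\<lambda>\<omega>. restrict (\<lambda>i. X i \<omega>) {N - 1}"
  have iv: "indep_var (?P {..<N - 1}) ?V (?P {N - 1}) ?U"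
    using N by (intro indep_var_restrict[OF ind]) auto
  have XN: "X (N - 1) \<omega> = B u \<omega> - B t \<omega>" for \<omega>
    using N LN by (simp add: X_def v_def)
  have V: "?V \<in> space M \<rightarrow> space (?P {..<N - 1})" by (auto simp: space_PiM)
  define F where "F = vimage_algebra (space M) ?V (?P {..<N - 1})"
  have VF: "?V \<in> measurable F (?P {..<N - 1})"
    unfolding F_def by (rule measurable_vimage_algebra1[OF V])
  have "(\<lambda>\<omega>. B s \<omega> - B 0 \<omega>) \<in> borel_measurable F" if s: "s \<in> I" for s
  proof -
    obtain k where k: "k < N" "L ! k = s" using setL s by (metis N_def in_set_conv_nth insertI2)
    have "B s \<omega> - B 0 \<omega> = (\<Sum>i<k. X i \<omega>)" for \<omega>
      using sum_lessThan_telescope[of "\<lambda>i. B (v i) \<omega>" k] k L0 N by (simp add: X_def v_def)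
    also have "(\<Sum>i<k. X i \<omega>) = (\<Sum>i<k. ?V \<omega> i)" for \<omega>
      using k by (intro sum.cong) auto
    finally have *: "(\<lambda>\<omega>. B s \<omega> - B 0 \<omega>) = (\<lambda>\<omega>. \<Sum>i<k. ?V \<omega> i)" by auto
    have "(\<lambda>\<omega>. ?V \<omega> i) \<in> borel_measurable F" if "i < k" for i
      using that k by (intro measurable_compose[OF VF measurable_component_singleton]) auto
    then show ?thesis unfolding * by (intro borel_measurable_sum) auto
  qed
  then have "cylinder_sets M B I \<subseteq> sets F"
    by (intro cylinder_sets_subset) (auto simp: F_def)
  with C have "C \<in> sets F" by auto
  then obtain D where D: "D \<in> sets (?P {..<N - 1})" "C = ?V -` D \<inter> space M"
    unfolding F_def sets_vimage_algebra2[OF V] by auto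
  define H' where "H' = {x \<in> space (?P {N - 1}). x (N - 1) \<in> H}"
  have H': "H' \<in> sets (?P {N - 1})"
    unfolding H'_def using H measurable_component_singleton[of "N - 1" "{N - 1}" "\<lambda>_. borel :: real measure"]
    by (auto intro!: sets_Collect_single simp: pred_def)
  have e: "?U -` H' \<inter> space M = (\<lambda>\<omega>. B u \<omega> - B t \<omega>) -` H \<inter> space M"
    by (auto simp: H'_def space_PiM XN[simplified])
  have CU: "(\<lambda>\<omega>. (?V \<omega>, ?U \<omega>)) -` (D \<times> H') \<inter> space M = C \<inter> (?U -` H' \<inter> space M)"
    unfolding D(2) by auto
  show ?thesis using indep_varD[OF iv D(1) H'] unfolding CU e D(2)[symmetric] .
qed

text \<open>On the generator, the probability factorises in two steps: first \<open>Z\<close> splits off from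
  everything that concerns \<open>B\<close>, then the future increment splits off from the cylinder set.\<close>

lemma past_indep_increment:
  assumes BM: "standard_brownian_motion M B" and Z: "Z \<in> borel_measurable M"
    and ZB: "indep_of_process M Z B" and t: "0 \<le> t" "t < u"
    and R: "R \<in> borel_measurable (past M Z B t)"
  shows "indep_var borel R borel (\<lambda>\<omega>. B u \<omega> - B t \<omega>)"
proof -
  let ?G = "\<lambda>\<omega>. B u \<omega> - B t \<omega>"
  let ?path = "\<lambda>\<omega>. \<lambda>t\<in>{0..}. B t \<omega>"
  define PB where "PB = vimage_algebra (space M) ?path (Pi\<^sub>M {0..} (\<lambda>_. borel :: real measure))"
  have path: "?path \<in> measurable PB (Pi\<^sub>M {0..} (\<lambda>_. borel))"
    unfolding PB_def by (rule measurable_vimage_algebra1) (auto simp: space_PiM)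
  have B_PB: "B s \<in> borel_measurable PB" if "0 \<le> s" for s
    using measurable_compose[OF path measurable_component_singleton[of s]] that by simp
  have cyl_PB: "cylinder_sets M B I \<subseteq> sets PB" if "I \<subseteq> {0..}" for I
    using that by (intro cylinder_sets_subset borel_measurable_diff B_PB) (auto simp: PB_def)
  have G: "?G \<in> borel_measurable M"
    using t by (intro borel_measurable_diff brownian_measurable[OF BM]) auto
  define GG where "GG = {?G -` H \<inter> space M | H. H \<in> sets borel}"
  have "indep_set (past_generator M Z B t) GG"
  proof (rule indep_setI[OF past_generator_events[OF BM Z]])
    show "GG \<subseteq> events" using G by (auto simp: GG_def intro: measurable_sets)
    fix a b assume "a \<in> past_generator M Z B t" "b \<in> GG"
    then obtain A C I H where
      a: "a = Z -` A \<inter> C" "A \<in> sets borel" "finite I" "I \<subseteq> {0..t}" "C \<in> cylinder_sets M B I"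
      and b: "b = ?G -` H \<inter> space M" "H \<in> sets borel"
      by (auto simp: past_generator_def GG_def)
    have ZA: "Z -` A \<inter> space M \<in> sets (vimage_algebra (space M) Z borel)"
      using a(2) by (auto simp: sets_vimage_algebra2)
    have C: "C \<in> sets PB" using cyl_PB[of I] a by (fastforce dest: subsetD)
    have "?G \<in> borel_measurable PB" using t by (intro borel_measurable_diff B_PB) auto
    from measurable_sets[OF this b(2)] have bP: "b \<in> sets PB" by (simp add: b(1) PB_def)
    have ind: "prob (Z -` A \<inter> space M \<inter> D) = prob (Z -` A \<inter> space M) * prob D" if "D \<in> sets PB" for D
      using indep_setD[OF ZB[unfolded indep_of_process_def, folded PB_def] ZA that] .
    have Cs: "C \<subseteq> space M" using a(5) by (rule cylinder_sets_into_space)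
    have "prob (a \<inter> b) = prob (Z -` A \<inter> space M \<inter> (C \<inter> b))"
      using Cs by (intro arg_cong[where f=prob]) (auto simp: a(1))
    also have "\<dots> = prob (Z -` A \<inter> space M) * prob (C \<inter> b)"
      using C bP by (intro ind) auto
    also have "prob (C \<inter> b) = prob C * prob b"
      unfolding b(1) by (rule cylinder_indep_increment[OF BM t a(3,4,5) b(2)])
    also have "prob (Z -` A \<inter> space M) * (prob C * prob b) = prob (Z -` A \<inter> space M \<inter> C) * prob b"
      using ind[OF C] by simp
    also have "Z -` A \<inter> space M \<inter> C = a" using Cs by (auto simp: a(1))
    finally show "prob (a \<inter> b) = prob a * prob b" .
  qed
  moreover have "Int_stable (past_generator M Z B t)"
  proof (rule Int_stableI)
    fix a b assume "a \<in> past_generator M Z B t" "b \<in> past_generator M Z B t"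
    then obtain A C I A' C' I' where
      a: "a = Z -` A \<inter> C" "A \<in> sets borel" "finite I" "I \<subseteq> {0..t}" "C \<in> cylinder_sets M B I"
      and b: "b = Z -` A' \<inter> C'" "A' \<in> sets borel" "finite I'" "I' \<subseteq> {0..t}" "C' \<in> cylinder_sets M B I'"
      by (auto simp: past_generator_def)
    have "C \<in> cylinder_sets M B (I \<union> I')" "C' \<in> cylinder_sets M B (I \<union> I')"
      by (rule subsetD[OF cylinder_sets_mono a(5)] subsetD[OF cylinder_sets_mono b(5)], simp)+
    then have "C \<inter> C' \<in> cylinder_sets M B (I \<union> I')" by (rule cylinder_sets_Int)
    moreover have "a \<inter> b = Z -` (A \<inter> A') \<inter> (C \<inter> C')" by (auto simp: a b)
    ultimately show "a \<inter> b \<in> past_generator M Z B t"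
      unfolding past_generator_def using a b
      by (intro CollectI exI[of _ "A \<inter> A'"] exI[of _ "C \<inter> C'"] conjI exI[of _ "I \<union> I'"]) auto
  qed
  moreover have "Int_stable GG"
  proof (rule Int_stableI)
    fix a b assume "a \<in> GG" "b \<in> GG"
    then obtain H H' where "a = ?G -` H \<inter> space M" "b = ?G -` H' \<inter> space M" "H \<in> sets borel" "H' \<in> sets borel"
      by (auto simp: GG_def)
    then show "a \<inter> b \<in> GG" unfolding GG_def by (intro CollectI exI[of _ "H \<inter> H'"]) auto
  qed
  ultimately have ind: "indep_set (sets (past M Z B t)) (sigma_sets (space M) GG)"
    unfolding sets_past by (rule indep_set_sigma_sets)
  have RM: "R \<in> borel_measurable M" by (rule past_measurable[OF BM Z R])
  have "sigma_sets (space M) {R -` A \<inter> space M | A. A \<in> sets borel} \<subseteq> sets (past M Z B t)"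
    unfolding space_past[of M Z B t, symmetric]
    by (rule sets.sigma_sets_subset) (use R in \<open>auto intro: measurable_sets\<close>)
  moreover have "sigma_sets (space M) {R -` A \<inter> space M | A. A \<in> sets borel} \<subseteq> events"
    by (rule sets.sigma_sets_subset) (use RM in \<open>auto intro: measurable_sets\<close>)
  moreover have "sigma_sets (space M) GG \<subseteq> events"
    by (rule sets.sigma_sets_subset) (use G in \<open>auto simp: GG_def intro: measurable_sets\<close>)
  ultimately have "indep_set (sigma_sets (space M) {R -` A \<inter> space M | A. A \<in> sets borel}) (sigma_sets (space M) GG)"
    by (intro indep_setI) (auto intro!: indep_setD[OF ind])
  with RM G show ?thesis unfolding indep_var_eq GG_def by simp
qed

text \<open>Fubini's theorem for the joint law of two independent variables: freeze the second one.\<close>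

lemma indep_var_prob_eq:
  assumes ind: "indep_var borel R borel G" and A: "A \<in> sets (borel \<Otimes>\<^sub>M borel)"
  shows "emeasure M {\<omega> \<in> space M. (R \<omega>, G \<omega>) \<in> A} =
    (\<integral>\<^sup>+\<omega>. emeasure M {\<omega>' \<in> space M. (R \<omega>', G \<omega>) \<in> A} \<partial>M)"
proof -
  have [measurable]: "R \<in> borel_measurable M" "G \<in> borel_measurable M"
    using indep_var_rv1[OF ind] indep_var_rv2[OF ind] by auto
  note [measurable] = A
  have joint: "distr M borel R \<Otimes>\<^sub>M distr M borel G = distr M (borel \<Otimes>\<^sub>M borel) (\<lambda>\<omega>. (R \<omega>, G \<omega>))"
    using ind by (simp add: indep_var_distribution_eq)
  interpret R: prob_space "distr M borel R" by (rule prob_space_distr) simp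
  interpret G: prob_space "distr M borel G" by (rule prob_space_distr) simp
  interpret pair_prob_space "distr M borel R" "distr M borel G" ..
  have "emeasure M {\<omega> \<in> space M. (R \<omega>, G \<omega>) \<in> A} = emeasure (distr M (borel \<Otimes>\<^sub>M borel) (\<lambda>\<omega>. (R \<omega>, G \<omega>))) A"
    by (subst emeasure_distr) (auto intro!: arg_cong[where f="emeasure M"])
  also have "\<dots> = emeasure (distr M borel R \<Otimes>\<^sub>M distr M borel G) A"
    by (simp add: joint)
  also have "\<dots> = (\<integral>\<^sup>+y. emeasure (distr M borel R) ((\<lambda>x. (x, y)) -` A) \<partial>distr M borel G)"
    by (rule emeasure_pair_measure_alt2) simp
  also have "\<dots> = (\<integral>\<^sup>+\<omega>. emeasure (distr M borel R) ((\<lambda>x. (x, G \<omega>)) -` A) \<partial>M)"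
    by (rule nn_integral_distr) (use measurable_emeasure_Pair2[of A] in simp_all)
  also have "\<dots> = (\<integral>\<^sup>+\<omega>. emeasure M {\<omega>' \<in> space M. (R \<omega>', G \<omega>) \<in> A} \<partial>M)"
    using sets_Pair2[OF A]
    by (intro nn_integral_cong, subst emeasure_distr) (auto intro!: arg_cong[where f="emeasure M"])
  finally show ?thesis .
qed

end

section \<open>Hitting times of a Brownian motion with deterministic drift\<close>

lemma (in prob_space) indep_var_commute:
  assumes "indep_var S X T Y"
  shows "indep_var T Y S X"
proof -
  have "indep_set b a" if "indep_set a b" for a b
    using that unfolding indep_sets2_eq by (metis Int_commute mult.commute)
  with assms show ?thesis unfolding indep_var_eq by blast
qed

locale driven_process = prob_space M for M :: "'a measure" +
  fixes Z :: "'a \<Rightarrow> real" and B :: "real \<Rightarrow> 'a \<Rightarrow> real" and \<Lambda> :: "real \<Rightarrow> real"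
  assumes Z_measurable: "Z \<in> borel_measurable M"
    and brownian: "standard_brownian_motion M B"
    and indep: "indep_of_process M Z B"
    and cadlag_drift: "cadlag \<Lambda>"
begin

abbreviation "X \<equiv> shifted_process Z B \<Lambda>"
abbreviation "hit \<equiv> hit_nonpos X"

lemma AE_path: "AE \<omega> in M. B 0 \<omega> = 0 \<and> continuous_on {0..} (\<lambda>t. B t \<omega>)"
  using brownian unfolding standard_brownian_motion_def by auto

lemma path_right_continuous:
  assumes "continuous_on {0..} (\<lambda>t. B t \<omega>)" "0 \<le> s"
  shows "continuous (at_right s) (\<lambda>s. X s \<omega>)"
proof -
  have "((\<lambda>t. B t \<omega>) \<longlongrightarrow> B s \<omega>) (at_right s)"
    by (rule tendsto_within_subset[of _ _ _ "{0..}"]) (use assms in \<open>auto simp: continuous_on_def\<close>)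
  then show ?thesis
    using cadlag_right[OF cadlag_drift assms(2)] unfolding continuous_within shifted_process_def
    by (intro tendsto_intros)
qed

lemma hit_le_iff:
  assumes "continuous_on {0..} (\<lambda>t. B t \<omega>)"
  shows "hit \<omega> \<le> ereal r \<longleftrightarrow> (\<exists>s. 0 \<le> s \<and> s \<le> r \<and> X s \<omega> \<le> 0)"
  using assms by (intro hit_nonpos_le_iff path_right_continuous)

lemma path_left_limit:
  assumes "continuous_on {0..} (\<lambda>t. B t \<omega>)" and t: "0 < t"
  shows "((\<lambda>s. X s \<omega>) \<longlongrightarrow> Z \<omega> + B t \<omega> - left_lim 0 \<Lambda> t) (at_left t)"
proof -
  have "((\<lambda>s. B s \<omega>) \<longlongrightarrow> B t \<omega>) (at_left t)"
    unfolding at_within_Icc_at_left[OF t, symmetric]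
    by (rule tendsto_within_subset[of _ _ _ "{0..}"]) (use assms in \<open>auto simp: continuous_on_def\<close>)
  then show ?thesis unfolding shifted_process_def
    by (intro tendsto_intros cadlag_left cadlag_drift t)
qed

lemma left_lim_path:
  assumes "B 0 \<omega> = 0" "continuous_on {0..} (\<lambda>t. B t \<omega>)" "0 \<le> t"
  shows "left_lim (Z \<omega>) (\<lambda>s. X s \<omega>) t = Z \<omega> + B t \<omega> - left_lim 0 \<Lambda> t"
proof (cases "t = 0")
  case False
  with assms show ?thesis by (intro left_lim_eq path_left_limit) auto
qed (use assms in \<open>simp add: left_lim_def\<close>)

text \<open>Adding an independent Gaussian variable removes every atom.\<close>

lemma no_atom:
  assumes s: "0 < s"
  shows "AE \<omega> in M. Z \<omega> + (B s \<omega> - B 0 \<omega>) \<noteq> c"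
proof -
  let ?G = "\<lambda>\<omega>. B s \<omega> - B 0 \<omega>"
  have G: "distributed M lborel ?G (normal_density 0 (sqrt (s - 0)))"
    by (rule brownian_increment_normal[OF brownian _ s]) simp
  have [measurable]: "?G \<in> borel_measurable M" "Z \<in> borel_measurable M"
    using distributed_measurable[OF G] Z_measurable by simp_all
  have "indep_var borel Z borel ?G"
    by (rule past_indep_increment[OF brownian Z_measurable indep _ s measurable_past_initial]) simp
  then have ind: "indep_var borel ?G borel Z" by (rule indep_var_commute)
  define A where "A = {p :: real \<times> real. snd p + fst p = c}"
  have A: "A \<in> sets (borel \<Otimes>\<^sub>M borel)" 
  proof -
    have "(\<lambda>p. snd p + fst p) \<in> borel_measurable (borel \<Otimes>\<^sub>M borel :: (real \<times> real) measure)" by measurable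
    from measurable_sets[OF this, of "{c}"] show ?thesis by (simp add: A_def space_pair_measure vimage_def)
  qed
  have "emeasure M {\<omega>' \<in> space M. (?G \<omega>', z) \<in> A} = 0" for z
  proof -
    have "{\<omega>' \<in> space M. (?G \<omega>', z) \<in> A} = ?G -` {c - z} \<inter> space M" by (auto simp: A_def)
    then have "emeasure M {\<omega>' \<in> space M. (?G \<omega>', z) \<in> A} =
        (\<integral>\<^sup>+x. ennreal (normal_density 0 (sqrt (s - 0)) x) * indicator {c - z} x \<partial>lborel)"
      using distributed_emeasure[OF G, of "{c - z}"] by simp
    also have "\<dots> = 0" by (intro nn_integral_null_set countable_imp_null_set_lborel) simp
    finally show ?thesis .
  qed
  then have "emeasure M {\<omega> \<in> space M. (?G \<omega>, Z \<omega>) \<in> A} = 0"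
    by (subst indep_var_prob_eq[OF ind A]) simp
  moreover have "{\<omega> \<in> space M. (?G \<omega>, Z \<omega>) \<in> A} = {\<omega> \<in> space M. \<not> Z \<omega> + ?G \<omega> \<noteq> c}"
    by (auto simp: A_def)
  ultimately show ?thesis by (intro AE_I[of _ _ "{\<omega> \<in> space M. \<not> Z \<omega> + ?G \<omega> \<noteq> c}"]) auto
qed

text \<open>The almost sure version of the event \<open>hit \<omega> \<le> r\<close> that inspects the path only at countably many
  times and hence belongs to the past of time \<open>r\<close>. The time \<open>r\<close> itself is among them, since the
  barrier may jump there.\<close>

definition hit_by :: "real \<Rightarrow> 'a \<Rightarrow> bool" where
  "hit_by r \<omega> \<longleftrightarrow> (\<forall>n. \<exists>q\<in>insert r (\<rat> \<inter> {0..r}). Z \<omega> + (B q \<omega> - B 0 \<omega>) - \<Lambda> q < 1 / Suc n)"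

lemma hit_le_AE_hit_by:
  assumes r: "0 \<le> r"
  shows "AE \<omega> in M. hit \<omega> \<le> ereal r \<longleftrightarrow> hit_by r \<omega>"
proof -
  have "AE \<omega> in M. \<forall>s\<in>{s. 0 < s \<and> \<Lambda> s < left_lim 0 \<Lambda> s}. Z \<omega> + (B s \<omega> - B 0 \<omega>) \<noteq> left_lim 0 \<Lambda> s"
    by (subst AE_ball_countable[OF countable_down_jumps[OF cadlag_drift]]) (auto intro: no_atom)
  with AE_path show ?thesis
  proof eventually_elim
    fix \<omega> assume *: "B 0 \<omega> = 0 \<and> continuous_on {0..} (\<lambda>t. B t \<omega>)"
      "\<forall>s\<in>{s. 0 < s \<and> \<Lambda> s < left_lim 0 \<Lambda> s}. Z \<omega> + (B s \<omega> - B 0 \<omega>) \<noteq> left_lim 0 \<Lambda> s"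
    have "(\<exists>s. 0 \<le> s \<and> s \<le> r \<and> Z \<omega> + B s \<omega> \<le> \<Lambda> s) \<longleftrightarrow>
        (\<forall>n. \<exists>q\<in>insert r (\<rat> \<inter> {0..r}). Z \<omega> + B q \<omega> - \<Lambda> q < 1 / Suc n)"
      using * by (intro ex_le_cadlag_iff_rational[OF _ cadlag_drift r]) (auto intro!: continuous_intros)
    then show "hit \<omega> \<le> ereal r \<longleftrightarrow> hit_by r \<omega>"
      using * by (simp add: hit_le_iff hit_by_def shifted_process_def)
  qed
qed

lemma hit_by_measurable_past:
  assumes "0 \<le> r" "r \<le> t"
  shows "Measurable.pred (past M Z B t) (hit_by r)"
proof -
  have "countable (insert r (\<rat> \<inter> {0..r}))" by (simp add: countable_rat)
  moreover have "(\<lambda>\<omega>. Z \<omega> + (B q \<omega> - B 0 \<omega>) - \<Lambda> q) \<in> borel_measurable (past M Z B t)"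
    if "q \<in> insert r (\<rat> \<inter> {0..r})" for q
    using that assms
    by (intro borel_measurable_diff[of "\<lambda>\<omega>. Z \<omega> + _ \<omega>"] borel_measurable_add measurable_past_initial
        measurable_past_increment borel_measurable_const) auto
  ultimately show ?thesis unfolding hit_by_def
    by (intro pred_intros_countable measurable_pred_countable borel_measurable_pred_less borel_measurable_const)
qed

lemma hit_le_measurable: "Measurable.pred (completion M) (\<lambda>\<omega>. hit \<omega> \<le> ereal r)"
proof (cases "0 \<le> r")
  case True
  have "Measurable.pred M (hit_by r)"
    by (rule past_measurable[OF brownian Z_measurable hit_by_measurable_past[OF True order_refl]])
  then show ?thesis
    by (intro pred_completion_cong_AE[OF hit_le_AE_hit_by[OF True]] measurable_completion)
next
  case False
  then have "\<not> hit \<omega> \<le> ereal r" for \<omega>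
    using le_hit_nonpos_iff[of 0 X \<omega>] by (metis ereal_less_eq(3) order_trans linorder_not_less)
  then show ?thesis by simp
qed

text \<open>The almost sure version of the event \<open>t \<le> hit \<omega>\<close>, obtained from \<open>hit_by\<close> along times that
  increase to \<open>t\<close>. At \<open>t = 0\<close> the event is certain.\<close>

definition unhit_before :: "real \<Rightarrow> 'a \<Rightarrow> bool" where
  "unhit_before t \<omega> \<longleftrightarrow> (0 < t \<longrightarrow> (\<forall>n::nat. \<not> hit_by (t * (1 - 1 / Suc n)) \<omega>))"

lemma hit_less_iff: "\<not> ereal t \<le> hit \<omega> \<longleftrightarrow> 0 < t \<and> (\<exists>n::nat. hit \<omega> \<le> ereal (t * (1 - 1 / Suc n)))"
proof (cases "0 < t")
  case True
  have "hit \<omega> < ereal t \<longleftrightarrow> (\<exists>n::nat. hit \<omega> \<le> ereal (t * (1 - 1 / Suc n)))"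
  proof
    assume "hit \<omega> < ereal t"
    then obtain r where r: "hit \<omega> < ereal r" "r < t"
      using ereal_dense2[of "hit \<omega>" "ereal t"] by auto
    obtain n where "1 / Suc n < (t - r) / t" using nat_approx_posE[of "(t - r) / t"] r True by auto
    then have "r \<le> t * (1 - 1 / Suc n)" using True by (simp add: field_simps)
    with r show "\<exists>n::nat. hit \<omega> \<le> ereal (t * (1 - 1 / Suc n))"
      by (intro exI[of _ n]) (auto intro: order_trans[OF less_imp_le])
  next
    assume "\<exists>n::nat. hit \<omega> \<le> ereal (t * (1 - 1 / Suc n))"
    then obtain n where "hit \<omega> \<le> ereal (t * (1 - 1 / Suc n))" by blast
    also have "ereal (t * (1 - 1 / Suc n)) < ereal t" using True by (simp add: field_simps)
    finally show "hit \<omega> < ereal t" .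
  qed
  then show ?thesis using True by (simp add: not_le)
qed (auto simp: le_hit_nonpos_iff)

lemma hit_ge_AE_unhit_before: "AE \<omega> in M. ereal t \<le> hit \<omega> \<longleftrightarrow> unhit_before t \<omega>"
proof (cases "0 < t")
  case True
  have "AE \<omega> in M. \<forall>n::nat. hit \<omega> \<le> ereal (t * (1 - 1 / Suc n)) \<longleftrightarrow> hit_by (t * (1 - 1 / Suc n)) \<omega>"
    using True by (intro AE_all_countable[THEN iffD2] allI hit_le_AE_hit_by) auto
  then show ?thesis
  proof eventually_elim
    case (elim \<omega>)
    then show ?case using hit_less_iff[of t \<omega>] True unfolding unhit_before_def by blast
  qed
qed (auto simp: unhit_before_def le_hit_nonpos_iff)

lemma unhit_before_measurable_past: "Measurable.pred (past M Z B t) (unhit_before t)"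
proof (cases "0 < t")
  case True
  have "Measurable.pred (past M Z B t) (hit_by (t * (1 - 1 / Suc n)))" for n
    using True by (intro hit_by_measurable_past) (auto simp: field_simps)
  then show ?thesis using True unfolding unhit_before_def by simp
qed (simp add: unhit_before_def[abs_def])

lemma hit_ge_measurable: "Measurable.pred (completion M) (\<lambda>\<omega>. ereal t \<le> hit \<omega>)"
  by (intro pred_completion_cong_AE[OF hit_ge_AE_unhit_before] measurable_completion
      past_measurable[OF brownian Z_measurable unhit_before_measurable_past])

lemma prob_hit_le_split:
  assumes "t \<le> r"
  shows "prob_of M (\<lambda>\<omega>. hit \<omega> \<le> ereal r) =
    prob_of M (\<lambda>\<omega>. \<not> ereal t \<le> hit \<omega>) + prob_of M (\<lambda>\<omega>. ereal t \<le> hit \<omega> \<and> hit \<omega> \<le> ereal r)"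
proof -
  have "hit \<omega> \<le> ereal r \<longleftrightarrow> \<not> ereal t \<le> hit \<omega> \<or> (ereal t \<le> hit \<omega> \<and> hit \<omega> \<le> ereal r)" for \<omega>
    using assms by (metis ereal_less_eq(3) linear order_trans)
  then have "prob_of M (\<lambda>\<omega>. hit \<omega> \<le> ereal r) =
      prob_of M (\<lambda>\<omega>. \<not> ereal t \<le> hit \<omega> \<or> (ereal t \<le> hit \<omega> \<and> hit \<omega> \<le> ereal r))"
    by simp
  also have "\<dots> = prob_of M (\<lambda>\<omega>. \<not> ereal t \<le> hit \<omega>) + prob_of M (\<lambda>\<omega>. ereal t \<le> hit \<omega> \<and> hit \<omega> \<le> ereal r)"
    using hit_ge_measurable hit_le_measurable
    by (intro prob_of_disjoint_Un pred_intros_logic) auto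
  finally show ?thesis .
qed

lemma prob_hit_le_left_limit:
  assumes t: "0 < t"
  shows "((\<lambda>s. prob_of M (\<lambda>\<omega>. hit \<omega> \<le> ereal s)) \<longlongrightarrow> prob_of M (\<lambda>\<omega>. \<not> ereal t \<le> hit \<omega>)) (at_left t)"
proof (rule tendsto_at_left_sequentially[of "t - 1"])
  fix S :: "nat \<Rightarrow> real" assume S: "\<And>n. S n < t" "incseq S" "S \<longlonglongrightarrow> t"
  interpret C: prob_space "completion M" by (rule prob_space_completion)
  define E where "E n = {\<omega> \<in> space M. hit \<omega> \<le> ereal (S n)}" for n
  have "(\<lambda>n. C.prob (E n)) \<longlonglongrightarrow> C.prob (\<Union>n. E n)"
  proof (rule C.finite_Lim_measure_incseq)
    show "range E \<subseteq> C.events" using hit_le_measurable by (auto simp: E_def pred_def)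
    show "incseq E" using S(2) unfolding E_def incseq_def by (auto intro: order_trans)
  qed
  also have "(\<Union>n. E n) = {\<omega> \<in> space M. \<not> ereal t \<le> hit \<omega>}"
  proof (intro equalityI subsetI)
    fix \<omega> assume "\<omega> \<in> {\<omega> \<in> space M. \<not> ereal t \<le> hit \<omega>}"
    then have \<omega>: "\<omega> \<in> space M" "hit \<omega> < ereal t" by auto
    then obtain r where r: "hit \<omega> < ereal r" "r < t"
      using ereal_dense2[of "hit \<omega>" "ereal t"] by auto
    have "eventually (\<lambda>n. r < S n) sequentially" using order_tendstoD(1)[OF S(3) r(2)] .
    then obtain n where "r < S n" by (meson eventually_happens sequentially_bot)
    with r \<omega> show "\<omega> \<in> (\<Union>n. E n)" unfolding E_def
      by (auto intro!: exI[of _ n] order_trans[OF less_imp_le[OF r(1)]])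
  next
    fix \<omega> assume "\<omega> \<in> (\<Union>n. E n)"
    then obtain n where "\<omega> \<in> space M" "hit \<omega> \<le> ereal (S n)" by (auto simp: E_def)
    then show "\<omega> \<in> {\<omega> \<in> space M. \<not> ereal t \<le> hit \<omega>}" using S(1)[of n]
      by (auto dest: order_trans)
  qed
  finally show "(\<lambda>n. prob_of M (\<lambda>\<omega>. hit \<omega> \<le> ereal (S n))) \<longlonglongrightarrow> prob_of M (\<lambda>\<omega>. \<not> ereal t \<le> hit \<omega>)"
    by (simp add: prob_of_def E_def)
qed simp

text \<open>At \<open>t = 0\<close> this rests on the sign of the initial value, at later times on the positivity of
  the path before the hitting time.\<close>

lemma left_limit_nonneg:
  assumes "AE \<omega> in M. 0 \<le> Z \<omega>" "0 \<le> t"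
  shows "AE \<omega> in M. ereal t \<le> hit \<omega> \<longrightarrow> 0 \<le> Z \<omega> + B t \<omega> - left_lim 0 \<Lambda> t"
  using assms(1) AE_path
proof eventually_elim
  fix \<omega> assume *: "0 \<le> Z \<omega>" "B 0 \<omega> = 0 \<and> continuous_on {0..} (\<lambda>t. B t \<omega>)"
  show "ereal t \<le> hit \<omega> \<longrightarrow> 0 \<le> Z \<omega> + B t \<omega> - left_lim 0 \<Lambda> t"
  proof (cases "t = 0")
    case True
    with * show ?thesis by (simp add: left_lim_def)
  next
    case False
    with assms have t: "0 < t" by simp
    show ?thesis
    proof
      assume h: "ereal t \<le> hit \<omega>"
      have lim: "((\<lambda>s. X s \<omega>) \<longlongrightarrow> Z \<omega> + B t \<omega> - left_lim 0 \<Lambda> t) (at_left t)"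
        using * t by (intro path_left_limit) auto
      have "eventually (\<lambda>s. 0 < s \<and> s < t) (at_left t)"
        using t by (auto simp: eventually_at_left_field intro!: exI[of _ 0])
      then have "eventually (\<lambda>s. 0 \<le> X s \<omega>) (at_left t)"
        by (rule eventually_mono) (use h in \<open>auto simp: le_hit_nonpos_iff intro: less_imp_le\<close>)
      then show "0 \<le> Z \<omega> + B t \<omega> - left_lim 0 \<Lambda> t"
        by (intro tendsto_lowerbound[OF lim]) auto
    qed
  qed
qed

end

section \<open>Reflection and the mass caught near a jump\<close>

lemma (in prob_space) brownian_uminus:
  assumes BM: "standard_brownian_motion M B"
  shows "standard_brownian_motion M (\<lambda>t \<omega>. - B t \<omega>)"
  unfolding standard_brownian_motion_def
proof (intro conjI allI impI)
  fix t :: real assume "0 \<le> t"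
  then show "(\<lambda>\<omega>. - B t \<omega>) \<in> borel_measurable M"
    using brownian_measurable[OF BM] by measurable
next
  show "AE \<omega> in M. - B 0 \<omega> = 0"
    using BM unfolding standard_brownian_motion_def by simp
  have "AE \<omega> in M. continuous_on {0..} (\<lambda>t. B t \<omega>)"
    using BM unfolding standard_brownian_motion_def by simp
  then show "AE \<omega> in M. continuous_on {0..} (\<lambda>t. - B t \<omega>)"
    by eventually_elim (rule continuous_on_minus)
next
  fix n :: nat and t :: "nat \<Rightarrow> real"
  assume "0 \<le> t 0 \<and> (\<forall>i<n. t i \<le> t (Suc i))"
  then have "indep_vars (\<lambda>_. borel) (\<lambda>i \<omega>. B (t (Suc i)) \<omega> - B (t i) \<omega>) {..<n}"
    using BM unfolding standard_brownian_motion_def by blast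
  then have "indep_vars (\<lambda>_. borel) (\<lambda>i \<omega>. - (B (t (Suc i)) \<omega> - B (t i) \<omega>)) {..<n}"
    by (rule indep_vars_compose2) simp
  then show "indep_vars (\<lambda>_. borel) (\<lambda>i \<omega>. - B (t (Suc i)) \<omega> - - B (t i) \<omega>) {..<n}"
    by (simp add: algebra_simps)
next
  fix s t :: real assume st: "0 \<le> s \<and> s < t"
  then have "distributed M lborel (\<lambda>\<omega>. - (B t \<omega> - B s \<omega>)) (normal_density 0 (sqrt (t - s)))"
    by (intro normal_uminus brownian_increment_normal[OF BM]) auto
  then show "distributed M lborel (\<lambda>\<omega>. - B t \<omega> - - B s \<omega>) (normal_density 0 (sqrt (t - s)))"
    by (simp add: algebra_simps)
qed

lemma sets_vimage_algebra_subset: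
  assumes "f \<in> measurable (vimage_algebra \<Omega> g N) K"
  shows "sets (vimage_algebra \<Omega> f K) \<subseteq> sets (vimage_algebra \<Omega> g N)"
proof -
  have "f \<in> \<Omega> \<rightarrow> space K" using measurable_space[OF assms] by auto
  then show ?thesis using measurable_sets[OF assms] by (auto simp: sets_vimage_algebra2)
qed

lemma (in prob_space) indep_of_process_uminus:
  assumes "indep_of_process M Z B"
  shows "indep_of_process M (\<lambda>\<omega>. - Z \<omega>) (\<lambda>t \<omega>. - B t \<omega>)"
proof -
  let ?P = "Pi\<^sub>M {0..} (\<lambda>_. borel :: real measure) :: (real \<Rightarrow> real) measure"
  let ?path = "\<lambda>\<omega>. \<lambda>t\<in>{0::real..}. B t \<omega>"
  let ?V = "vimage_algebra (space M) ?path ?P"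
  have "Z \<in> borel_measurable (vimage_algebra (space M) Z borel)"
    by (rule measurable_vimage_algebra1) simp
  then have Z: "sets (vimage_algebra (space M) (\<lambda>\<omega>. - Z \<omega>) borel) \<subseteq> sets (vimage_algebra (space M) Z borel)"
    by (intro sets_vimage_algebra_subset) measurable
  have path: "?path \<in> measurable ?V ?P"
    by (rule measurable_vimage_algebra1) (auto simp: space_PiM)
  have "B s \<in> borel_measurable ?V" if "0 \<le> s" for s
    using measurable_compose[OF path measurable_component_singleton[of s]] that by simp
  then have "(\<lambda>\<omega>. \<lambda>t\<in>{0..}. - B t \<omega>) \<in> measurable ?V ?P"
    by (intro measurable_restrict borel_measurable_uminus) auto
  from sets_vimage_algebra_subset[OF this] Z assms show ?thesis
    unfolding indep_of_process_def indep_sets2_eq by blast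
qed

lemma driven_process_uminus:
  assumes "driven_process M Z B \<Lambda>"
  shows "driven_process M (\<lambda>\<omega>. - Z \<omega>) (\<lambda>t \<omega>. - B t \<omega>) (\<lambda>t. - \<Lambda> t)"
proof -
  interpret driven_process M Z B \<Lambda> by fact
  show ?thesis
    by unfold_locales
      (use Z_measurable brownian indep cadlag_drift
       in \<open>simp_all add: brownian_uminus indep_of_process_uminus cadlag_uminus\<close>)
qed

context driven_process
begin

text \<open>If at least mass \<open>x / \<alpha>\<close> of the surviving particles lies in \<open>[0, x]\<close> for every \<open>x \<le> x1\<close>, then a
  random level that is independent of the past and takes values in \<open>(0, x1]\<close> has on average at
  least its own mean divided by \<open>\<alpha>\<close> below it. Assigning the value \<open>x1 + 1\<close> to the other particles
  turns the mass condition into a lower bound for a distribution function.\<close>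

lemma expected_level_le:
  assumes t: "0 \<le> t" "t < u" and \<alpha>: "0 < \<alpha>"
    and mass: "\<And>x. 0 < x \<Longrightarrow> x \<le> x1 \<Longrightarrow>
      x \<le> \<alpha> * prob_of M (\<lambda>\<omega>. ereal t \<le> hit \<omega> \<and> Z \<omega> + B t \<omega> - left_lim 0 \<Lambda> t \<in> {0..x})"
    and V: "V \<in> borel_measurable borel" "\<And>g. 0 < V g" "\<And>g. V g \<le> x1"
  shows "expectation (\<lambda>\<omega>. V (B u \<omega> - B t \<omega>)) \<le>
    \<alpha> * prob_of M (\<lambda>\<omega>. ereal t \<le> hit \<omega> \<and> Z \<omega> + B t \<omega> - left_lim 0 \<Lambda> t \<le> V (B u \<omega> - B t \<omega>))"
proof -
  let ?G = "\<lambda>\<omega>. B u \<omega> - B t \<omega>"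
  let ?L = "left_lim 0 \<Lambda> t"
  define X' where "X' \<omega> = Z \<omega> + (B t \<omega> - B 0 \<omega>) - ?L" for \<omega>
  define R where "R \<omega> = (if unhit_before t \<omega> \<and> 0 \<le> X' \<omega> then X' \<omega> else x1 + 1)" for \<omega>
  have X': "X' \<in> borel_measurable (past M Z B t)"
    unfolding X'_def
    using measurable_past_initial[of Z M B t] measurable_past_increment[of t t B M Z] t by measurable
  note [measurable] = unhit_before_measurable_past V(1)
  have Rpast: "R \<in> borel_measurable (past M Z B t)"
    unfolding R_def using X' by measurable
  have [measurable]: "R \<in> borel_measurable M" "?G \<in> borel_measurable M" "Z \<in> borel_measurable M" "B t \<in> borel_measurable M"
    using past_measurable[OF brownian Z_measurable Rpast] Z_measurable brownian_measurable[OF brownian] t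
    by auto
  have ind: "indep_var borel R borel ?G"
    by (rule past_indep_increment[OF brownian Z_measurable indep t Rpast])
  have R: "AE \<omega> in M. \<forall>x\<le>x1. (ereal t \<le> hit \<omega> \<and> Z \<omega> + B t \<omega> - ?L \<in> {0..x}) \<longleftrightarrow> R \<omega> \<le> x"
    using hit_ge_AE_unhit_before[of t] AE_path by eventually_elim (auto simp: R_def X'_def)
  have cdf: "ennreal (x / \<alpha>) \<le> emeasure M {\<omega> \<in> space M. R \<omega> \<le> x}" if x: "0 < x" "x \<le> x1" for x
  proof -
    have "prob_of M (\<lambda>\<omega>. ereal t \<le> hit \<omega> \<and> Z \<omega> + B t \<omega> - ?L \<in> {0..x}) = prob_of M (\<lambda>\<omega>. R \<omega> \<le> x)"
      by (rule prob_of_cong_AE) (use R x in \<open>auto elim: eventually_mono\<close>)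
    also have "\<dots> = \<P>(\<omega> in M. R \<omega> \<le> x)" by (rule prob_of_eq_prob) measurable
    finally show ?thesis using mass[OF x] \<alpha> by (simp add: emeasure_eq_measure field_simps)
  qed
  define A where "A = {p \<in> space (borel \<Otimes>\<^sub>M borel). fst p \<le> V (snd p)}"
  have A: "A \<in> sets (borel \<Otimes>\<^sub>M borel)" unfolding A_def by measurable
  have "ennreal (expectation (\<lambda>\<omega>. V (?G \<omega>) / \<alpha>)) = (\<integral>\<^sup>+\<omega>. ennreal (V (?G \<omega>) / \<alpha>) \<partial>M)"
  proof (rule nn_integral_eq_integral[symmetric])
    show "integrable M (\<lambda>\<omega>. V (?G \<omega>) / \<alpha>)"
    proof (rule integrable_const_bound[of _ "x1 / \<alpha>"])
      show "AE \<omega> in M. norm (V (?G \<omega>) / \<alpha>) \<le> x1 / \<alpha>"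
      proof (rule AE_I2)
        fix \<omega>
        show "norm (V (?G \<omega>) / \<alpha>) \<le> x1 / \<alpha>"
          using V(2,3)[of "?G \<omega>"] \<alpha> by (simp add: divide_right_mono)
      qed
    qed measurable
  qed (use V(2) \<alpha> in \<open>auto intro!: less_imp_le\<close>)
  also have "\<dots> \<le> (\<integral>\<^sup>+\<omega>. emeasure M {\<omega>' \<in> space M. (R \<omega>', ?G \<omega>) \<in> A} \<partial>M)"
    using cdf[OF V(2,3)] by (intro nn_integral_mono) (simp add: A_def space_pair_measure)
  also have "\<dots> = emeasure M {\<omega> \<in> space M. (R \<omega>, ?G \<omega>) \<in> A}"
    by (rule indep_var_prob_eq[OF ind A, symmetric])
  also have "\<dots> = ennreal (\<P>(\<omega> in M. R \<omega> \<le> V (?G \<omega>)))"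
    by (simp add: A_def space_pair_measure emeasure_eq_measure)
  finally have "expectation (\<lambda>\<omega>. V (?G \<omega>)) \<le> \<alpha> * \<P>(\<omega> in M. R \<omega> \<le> V (?G \<omega>))"
    using \<alpha> by (simp add: field_simps)
  also have "\<P>(\<omega> in M. R \<omega> \<le> V (?G \<omega>)) = prob_of M (\<lambda>\<omega>. R \<omega> \<le> V (?G \<omega>))"
    by (rule prob_of_eq_prob[symmetric]) measurable
  also have "\<dots> \<le> prob_of M (\<lambda>\<omega>. ereal t \<le> hit \<omega> \<and> Z \<omega> + B t \<omega> - ?L \<le> V (?G \<omega>))"
  proof (rule prob_of_mono_AE)
    show "AE \<omega> in M. R \<omega> \<le> V (?G \<omega>) \<longrightarrow> ereal t \<le> hit \<omega> \<and> Z \<omega> + B t \<omega> - ?L \<le> V (?G \<omega>)"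
      using R by eventually_elim (use V(3) in auto)
    have "Measurable.pred (completion M) (\<lambda>\<omega>. Z \<omega> + B t \<omega> - ?L \<le> V (?G \<omega>))"
      by (rule measurable_completion) measurable
    then show "Measurable.pred (completion M) (\<lambda>\<omega>. ereal t \<le> hit \<omega> \<and> Z \<omega> + B t \<omega> - ?L \<le> V (?G \<omega>))"
      using hit_ge_measurable by (intro pred_intros_logic) auto
  qed
  finally show ?thesis using \<alpha> by simp
qed

text \<open>A particle that has survived until \<open>t\<close> is caught by time \<open>u\<close> as soon as it is non-positive at
  one of the two times \<open>t\<close> and \<open>u\<close>. In terms of its position just before \<open>t\<close> this means that it
  lies below the level \<open>max J (D - G)\<close>, where \<open>J\<close> and \<open>D\<close> are the displacements of the drift at
  times \<open>t\<close> and \<open>u\<close> and \<open>G\<close> is the Brownian increment. Looking at both times, rather than only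
  at \<open>u\<close>, is what produces the strict gain in the final estimate.\<close>

lemma prob_hit_between_ge:
  assumes t: "0 \<le> t" "t < u" and \<alpha>: "0 < \<alpha>"
    and mass: "\<And>x. 0 < x \<Longrightarrow> x \<le> x1 \<Longrightarrow>
      x \<le> \<alpha> * prob_of M (\<lambda>\<omega>. ereal t \<le> hit \<omega> \<and> Z \<omega> + B t \<omega> - left_lim 0 \<Lambda> t \<in> {0..x})"
    and J: "left_lim 0 \<Lambda> t < \<Lambda> t" and x1: "0 < x1"
  shows "expectation (\<lambda>\<omega>. min x1 (max (\<Lambda> t - left_lim 0 \<Lambda> t) (\<Lambda> u - left_lim 0 \<Lambda> t - (B u \<omega> - B t \<omega>))))
    \<le> \<alpha> * prob_of M (\<lambda>\<omega>. ereal t \<le> hit \<omega> \<and> hit \<omega> \<le> ereal u)"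
proof -
  let ?L = "left_lim 0 \<Lambda> t"
  define V where "V g = min x1 (max (\<Lambda> t - ?L) (\<Lambda> u - ?L - g))" for g
  have "expectation (\<lambda>\<omega>. V (B u \<omega> - B t \<omega>)) \<le>
    \<alpha> * prob_of M (\<lambda>\<omega>. ereal t \<le> hit \<omega> \<and> Z \<omega> + B t \<omega> - ?L \<le> V (B u \<omega> - B t \<omega>))"
    by (rule expected_level_le[OF t \<alpha> mass]) (use J x1 in \<open>auto simp: V_def[abs_def]\<close>)
  also have "\<dots> \<le> \<alpha> * prob_of M (\<lambda>\<omega>. ereal t \<le> hit \<omega> \<and> hit \<omega> \<le> ereal u)"
  proof (intro mult_left_mono prob_of_mono_AE)
    show "AE \<omega> in M. ereal t \<le> hit \<omega> \<and> Z \<omega> + B t \<omega> - ?L \<le> V (B u \<omega> - B t \<omega>) \<longrightarrow>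
        ereal t \<le> hit \<omega> \<and> hit \<omega> \<le> ereal u"
      using AE_path
    proof eventually_elim
      fix \<omega> assume c: "B 0 \<omega> = 0 \<and> continuous_on {0..} (\<lambda>t. B t \<omega>)"
      have "X t \<omega> \<le> 0 \<or> X u \<omega> \<le> 0" if "Z \<omega> + B t \<omega> - ?L \<le> V (B u \<omega> - B t \<omega>)"
        using that by (auto simp: V_def shifted_process_def)
      then show "ereal t \<le> hit \<omega> \<and> Z \<omega> + B t \<omega> - ?L \<le> V (B u \<omega> - B t \<omega>) \<longrightarrow>
        ereal t \<le> hit \<omega> \<and> hit \<omega> \<le> ereal u"
        using t c hit_le_iff[of \<omega> u] by (meson less_imp_le order_refl order_trans)
    qed
    show "Measurable.pred (completion M) (\<lambda>\<omega>. ereal t \<le> hit \<omega> \<and> hit \<omega> \<le> ereal u)"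
      using hit_ge_measurable hit_le_measurable by (intro pred_intros_logic) auto
  qed (use \<alpha> in simp)
  finally show ?thesis by (simp add: V_def)
qed

text \<open>When the drift has just pushed all surviving particles away by at least \<open>c\<close>, being caught soon
  requires a Brownian fluctuation of size \<open>c\<close>.\<close>

lemma prob_hit_between_le:
  assumes Z: "AE \<omega> in M. 0 \<le> Z \<omega>" and t: "0 \<le> t" "0 < h" and b: "0 < b" "b < c"
    and drop: "\<And>s. t \<le> s \<Longrightarrow> s \<le> t + h \<Longrightarrow> \<Lambda> s - left_lim 0 \<Lambda> t \<le> - c"
  shows "prob_of M (\<lambda>\<omega>. ereal t \<le> hit \<omega> \<and> hit \<omega> \<le> ereal (t + h)) \<le> 2 * (h * normal_density 0 (sqrt h) b / b)"
proof -
  let ?W = "\<lambda>t \<omega>. - B t \<omega>"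
  note BM = brownian_uminus[OF brownian]
  have N: "distributed M lborel (\<lambda>\<omega>. ?W (t + h) \<omega> - ?W t \<omega>) (normal_density 0 (sqrt h))"
    using brownian_increment_normal[OF BM, of t "t + h"] t by simp
  have meas: "Measurable.pred (completion M) (\<lambda>\<omega>. ereal t \<le> hit \<omega> \<and> hit \<omega> \<le> ereal (t + h))"
    using hit_ge_measurable hit_le_measurable by (intro pred_intros_logic) auto
  have "AE \<omega> in M. ereal t \<le> hit \<omega> \<and> hit \<omega> \<le> ereal (t + h) \<longrightarrow>
      (\<exists>s. t \<le> s \<and> s \<le> t + h \<and> c \<le> ?W s \<omega> - ?W t \<omega>)"
    using left_limit_nonneg[OF Z t(1)] AE_path
  proof eventually_elim
    fix \<omega> assume *: "ereal t \<le> hit \<omega> \<longrightarrow> 0 \<le> Z \<omega> + B t \<omega> - left_lim 0 \<Lambda> t"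
      "B 0 \<omega> = 0 \<and> continuous_on {0..} (\<lambda>t. B t \<omega>)"
    show "ereal t \<le> hit \<omega> \<and> hit \<omega> \<le> ereal (t + h) \<longrightarrow>
      (\<exists>s. t \<le> s \<and> s \<le> t + h \<and> c \<le> ?W s \<omega> - ?W t \<omega>)"
    proof
      assume h: "ereal t \<le> hit \<omega> \<and> hit \<omega> \<le> ereal (t + h)"
      then obtain s where s: "0 \<le> s" "s \<le> t + h" "X s \<omega> \<le> 0" using * by (auto simp: hit_le_iff)
      with h have "t \<le> s" by (meson le_hit_nonpos_iff linorder_not_less)
      with s * h drop[of s] show "\<exists>s. t \<le> s \<and> s \<le> t + h \<and> c \<le> ?W s \<omega> - ?W t \<omega>"
        by (intro exI[of _ s]) (auto simp: shifted_process_def)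
    qed
  qed
  then have "prob_of M (\<lambda>\<omega>. ereal t \<le> hit \<omega> \<and> hit \<omega> \<le> ereal (t + h)) \<le> 2 * \<P>(\<omega> in M. b \<le> ?W (t + h) \<omega> - ?W t \<omega>)"
    by (rule brownian_maximal_AE[OF BM t b(2)])
  also have "\<dots> \<le> 2 * (h * normal_density 0 (sqrt h) b / b)"
    using normal_tail_upper[OF N _ b(1)] t by simp
  finally show ?thesis .
qed

end

text \<open>Without truncation the mean of \<open>D - G\<close> is \<open>D\<close>. The lower truncation at \<open>J\<close> gains at least \<open>d\<close>
  when \<open>G \<ge> 2 * d\<close>; the upper truncation at \<open>x1\<close> loses at most \<open>- G\<close> and only when
  \<open>- G \<ge> a\<close>. Gain and loss are expressed by the Gaussian density at \<open>3 * d\<close> and at \<open>a\<close>.\<close>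

lemma (in prob_space) normal_truncation_gain:
  assumes G: "distributed M lborel G (normal_density 0 (sqrt h))" and h: "0 < h"
    and d: "0 < d" "\<bar>D - J\<bar> \<le> d" and a: "0 < a" "J + a + d \<le> x1" 
  shows "D + d * (d * normal_density 0 (sqrt h) (3 * d)) - h * normal_density 0 (sqrt h) a \<le>
    expectation (\<lambda>\<omega>. min x1 (max J (D - G \<omega>)))"
proof -
  have [measurable]: "G \<in> borel_measurable M"
    using distributed_measurable[OF G] by simp
  have s: "0 < sqrt h" using h by simp
  note tail = normal_tail_expectation[OF normal_uminus[OF G s] s, of a]
  have EG: "expectation G = 0"
    using normal_distributed_expectation[OF _ G] s by simp
  have intG: "integrable M G"
    using integrable_normal_moment_nz_1[OF s] distributed_integrable[OF G, of "\<lambda>x. x"] by simp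
  have intV: "integrable M (\<lambda>\<omega>. min x1 (max J (D - G \<omega>)))"
    using intG by (intro integrable_min integrable_max Bochner_Integration.integrable_diff integrable_const)
  have intI: "integrable M (\<lambda>\<omega>. d * indicator {\<omega> \<in> space M. 2 * d \<le> G \<omega>} \<omega>)"
    by (intro integrable_mult_right integrable_real_indicator) (auto simp: emeasure_eq_measure)
  have "D + d * \<P>(\<omega> in M. 2 * d \<le> G \<omega>) - h * normal_density 0 (sqrt h) a =
    expectation (\<lambda>\<omega>. (D - G \<omega>) + d * indicator {\<omega> \<in> space M. 2 * d \<le> G \<omega>} \<omega> - (- G \<omega>) * indicator {a..} (- G \<omega>))"
  proof -
    have "expectation (\<lambda>\<omega>. (D - G \<omega>) + d * indicator {\<omega> \<in> space M. 2 * d \<le> G \<omega>} \<omega> - (- G \<omega>) * indicator {a..} (- G \<omega>))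
      = expectation (\<lambda>\<omega>. (D - G \<omega>) + d * indicator {\<omega> \<in> space M. 2 * d \<le> G \<omega>} \<omega>) - expectation (\<lambda>\<omega>. (- G \<omega>) * indicator {a..} (- G \<omega>))"
      using a intG intI tail(1) by (intro Bochner_Integration.integral_diff) auto
    also have "expectation (\<lambda>\<omega>. (D - G \<omega>) + d * indicator {\<omega> \<in> space M. 2 * d \<le> G \<omega>} \<omega>) =
       expectation (\<lambda>\<omega>. D - G \<omega>) + expectation (\<lambda>\<omega>. d * indicator {\<omega> \<in> space M. 2 * d \<le> G \<omega>} \<omega>)"
      using intG intI by (intro Bochner_Integration.integral_add) auto
    also have "expectation (\<lambda>\<omega>. D - G \<omega>) = D - expectation G"
      using intG by (simp add: prob_space)
    finally show ?thesis using tail(2) a EG h by simp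
  qed
  also have "\<dots> \<le> expectation (\<lambda>\<omega>. min x1 (max J (D - G \<omega>)))"
  proof (rule integral_mono)
    show "integrable M (\<lambda>\<omega>. D - G \<omega> + d * indicator {\<omega> \<in> space M. 2 * d \<le> G \<omega>} \<omega> - (- G \<omega>) * indicator {a..} (- G \<omega>))"
      using a intG intI tail(1) by auto
    show "D - G \<omega> + d * indicator {\<omega> \<in> space M. 2 * d \<le> G \<omega>} \<omega> - (- G \<omega>) * indicator {a..} (- G \<omega>)
      \<le> min x1 (max J (D - G \<omega>))" if "\<omega> \<in> space M" for \<omega>
      using d a that by (auto simp: indicator_def min_def max_def abs_le_iff)
  qed (rule intV)
  finally have "D + d * \<P>(\<omega> in M. 2 * d \<le> G \<omega>) - h * normal_density 0 (sqrt h) a \<le>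
    expectation (\<lambda>\<omega>. min x1 (max J (D - G \<omega>)))" .
  moreover have "d * (d * normal_density 0 (sqrt h) (3 * d)) \<le> d * \<P>(\<omega> in M. 2 * d \<le> G \<omega>)"
    using normal_tail_lower[OF G, of "2 * d" d] d by (intro mult_left_mono) auto
  ultimately show ?thesis by linarith
qed

section \<open>The size of the jumps\<close>

text \<open>If the jump \<open>J\<close> were smaller than the infimum, the mass condition would hold up to some
  \<open>x1 > J\<close>. Balance the change \<open>D\<close> of \<open>\<Lambda>\<close> from just before \<open>t\<close> to \<open>t + h\<close> for small \<open>h\<close>: the
  particles of \<open>X\<close> contribute at least \<open>D\<close> plus a gain, the loss by truncation and the
  particles of the reflected process \<open>Y\<close> are of smaller order, so \<open>D > D\<close>.
  Both processes are written as starting on the positive side, so that the same statement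
  also covers downward jumps after exchanging their roles.\<close>

lemma upward_jump_ge:
  assumes Xp: "driven_process M Z B \<Lambda>" and Yp: "driven_process M Z' B' (\<lambda>t. - \<Lambda> t)"
    and Z': "AE \<omega> in M. 0 \<le> Z' \<omega>"
    and \<alpha>: "0 < \<alpha>" and \<beta>: "0 < \<beta>"
    and \<Lambda>: "\<And>t. 0 \<le> t \<Longrightarrow> \<Lambda> t =
      \<alpha> * prob_of M (\<lambda>\<omega>. hit_nonpos (shifted_process Z B \<Lambda>) \<omega> \<le> ereal t) -
      \<beta> * prob_of M (\<lambda>\<omega>. hit_nonpos (shifted_process Z' B' (\<lambda>t. - \<Lambda> t)) \<omega> \<le> ereal t)"
    and t: "0 \<le> t" and jump: "left_lim 0 \<Lambda> t < \<Lambda> t"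
  shows "Inf {x. 0 < x \<and> \<alpha> * prob_of M (\<lambda>\<omega>. ereal t \<le> hit_nonpos (shifted_process Z B \<Lambda>) \<omega> \<and>
      Z \<omega> + B t \<omega> - left_lim 0 \<Lambda> t \<in> {0..x}) < x} \<le> \<Lambda> t - left_lim 0 \<Lambda> t"
    (is "Inf ?S \<le> ?J")
proof (rule ccontr)
  interpret X: driven_process M Z B \<Lambda> by fact
  interpret Y: driven_process M Z' B' "\<lambda>t. - \<Lambda> t" by fact
  let ?L = "left_lim 0 \<Lambda> t"
  assume "\<not> Inf ?S \<le> ?J"
  then have "?J < Inf ?S" by simp
  then obtain x1 where x1: "?J < x1" "x1 < Inf ?S" using dense by blast
  have J: "0 < ?J" using jump by simp
  have mass: "x \<le> \<alpha> * prob_of M (\<lambda>\<omega>. ereal t \<le> X.hit \<omega> \<and> Z \<omega> + B t \<omega> - ?L \<in> {0..x})"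
    if "0 < x" "x \<le> x1" for x
  proof (rule ccontr)
    assume "\<not> ?thesis"
    with that have "x \<in> ?S" by auto
    moreover have "bdd_below ?S" by (rule bdd_belowI[of _ 0]) auto
    ultimately have "Inf ?S \<le> x" by (rule cInf_lower)
    with that x1 show False by simp
  qed
  \<comment> \<open>The choice \<open>3 * d = a\<close> makes the gain \<open>d\<^sup>2 * \<phi>\<close> and both errors, of size \<open>h * \<phi>\<close>, multiples of the same
      density value \<open>\<phi>\<close>; only their polynomial factors remain to be compared.\<close>
  define a where "a = min ?J (x1 - ?J) / 2"
  define d where "d = a / 3"
  have a: "0 < a" "2 * a \<le> ?J" "?J + 2 * a \<le> x1" using J x1 by (auto simp: a_def min_def)
  have d: "0 < d" "3 * d = a" using a by (auto simp: d_def)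
  have "(\<Lambda> \<longlongrightarrow> \<Lambda> t) (at_right t)" by (rule cadlag_right[OF X.cadlag_drift t])
  then have "eventually (\<lambda>s. dist (\<Lambda> s) (\<Lambda> t) < d) (at_right t)" using d(1) by (rule tendstoD)
  then obtain b where b: "t < b" "\<And>s. t < s \<Longrightarrow> s < b \<Longrightarrow> \<bar>\<Lambda> s - \<Lambda> t\<bar> < d"
    unfolding eventually_at_right_field dist_real_def by blast
  \<comment> \<open>The two errors together amount to \<open>h * k * \<phi>\<close>.\<close>
  define k where "k = 1 + 2 * \<beta> / a"
  have k: "0 < k" using a \<beta> by (simp add: k_def add_pos_pos)
  define h where "h = min ((b - t) / 2) (d\<^sup>2 / (2 * k))"
  have h: "0 < h" "t + h < b" "h * k < d\<^sup>2"
  proof -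
    show "0 < h" using b d k by (simp add: h_def)
    have "h \<le> (b - t) / 2" unfolding h_def by (rule min.cobounded1)
    then have "2 * h \<le> b - t" by simp
    then show "t + h < b" using b(1) \<open>0 < h\<close> by linarith
    have "h \<le> d\<^sup>2 / (2 * k)" unfolding h_def by (rule min.cobounded2)
    then have "h * k \<le> d\<^sup>2 / 2" using k by (simp add: field_simps)
    moreover have "0 < d\<^sup>2" using d(1) by simp
    ultimately show "h * k < d\<^sup>2" by linarith
  qed
  have close: "\<bar>\<Lambda> s - \<Lambda> t\<bar> \<le> d" if "t \<le> s" "s \<le> t + h" for s
    using b(2)[of s] that h d by (cases "s = t") auto
  define p where "p = prob_of M (\<lambda>\<omega>. ereal t \<le> X.hit \<omega> \<and> X.hit \<omega> \<le> ereal (t + h))"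
  define q where "q = prob_of M (\<lambda>\<omega>. ereal t \<le> Y.hit \<omega> \<and> Y.hit \<omega> \<le> ereal (t + h))"
  define D where "D = \<Lambda> (t + h) - ?L"
  define \<phi> where "\<phi> = normal_density 0 (sqrt h) a"
  have L: "?L = \<alpha> * prob_of M (\<lambda>\<omega>. \<not> ereal t \<le> X.hit \<omega>) - \<beta> * prob_of M (\<lambda>\<omega>. \<not> ereal t \<le> Y.hit \<omega>)"
  proof (cases "t = 0")
    case True
    then show ?thesis
      by (simp add: left_lim_def le_hit_nonpos_iff[of 0, unfolded zero_ereal_def[symmetric]] prob_of_def zero_ereal_def[symmetric])
  next
    case False
    with t have t0: "0 < t" by simp
    have "((\<lambda>s. \<alpha> * prob_of M (\<lambda>\<omega>. X.hit \<omega> \<le> ereal s) - \<beta> * prob_of M (\<lambda>\<omega>. Y.hit \<omega> \<le> ereal s)) \<longlongrightarrow>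
        \<alpha> * prob_of M (\<lambda>\<omega>. \<not> ereal t \<le> X.hit \<omega>) - \<beta> * prob_of M (\<lambda>\<omega>. \<not> ereal t \<le> Y.hit \<omega>)) (at_left t)"
      by (intro tendsto_intros X.prob_hit_le_left_limit Y.prob_hit_le_left_limit t0)
    moreover have "eventually (\<lambda>s. 0 < s) (at_left t)"
      using t0 by (auto simp: eventually_at_left_field intro!: exI[of _ 0])
    then have "eventually (\<lambda>s. \<alpha> * prob_of M (\<lambda>\<omega>. X.hit \<omega> \<le> ereal s) - \<beta> * prob_of M (\<lambda>\<omega>. Y.hit \<omega> \<le> ereal s) = \<Lambda> s) (at_left t)"
      by (rule eventually_mono) (simp add: \<Lambda>)
    ultimately show ?thesis
      by (intro left_lim_eq[OF t0]) (rule Lim_transform_eventually)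
  qed
  have D: "D = \<alpha> * p - \<beta> * q"
    unfolding D_def L p_def q_def using \<Lambda>[of "t + h"] t h
      X.prob_hit_le_split[of t "t + h"] Y.prob_hit_le_split[of t "t + h"]
    by (simp add: algebra_simps)
  have G: "distributed M lborel (\<lambda>\<omega>. B (t + h) \<omega> - B t \<omega>) (normal_density 0 (sqrt h))"
    using X.brownian_increment_normal[OF X.brownian t, of "t + h"] h by simp
  have "D + d * (d * \<phi>) - h * \<phi> \<le> X.expectation (\<lambda>\<omega>. min x1 (max ?J (D - (B (t + h) \<omega> - B t \<omega>))))"
    using X.normal_truncation_gain[OF G h(1) d(1) _ a(1), of D ?J x1] close[of "t + h"] h a d
    by (simp add: D_def \<phi>_def d(2))
  also have "\<dots> \<le> \<alpha> * p"
    unfolding p_def D_def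
    by (rule X.prob_hit_between_ge[OF t _ \<alpha> mass jump]) (use h J x1 in auto)
  finally have lower: "D + d * (d * \<phi>) - h * \<phi> \<le> \<alpha> * p" .
  have upper: "q \<le> 2 * (h * \<phi> / a)"
    unfolding q_def \<phi>_def
  proof (rule Y.prob_hit_between_le[OF Z' t h(1) a(1)])
    show "a < ?J - d" using a d by simp
    fix s assume "t \<le> s" "s \<le> t + h"
    then show "- \<Lambda> s - left_lim 0 (\<lambda>t. - \<Lambda> t) t \<le> - (?J - d)"
      using close[of s] left_lim_uminus[OF X.cadlag_drift t] by (simp add: abs_le_iff)
  qed
  have "0 < \<phi>" unfolding \<phi>_def using h by (intro normal_density_pos) simp
  have "d * (d * \<phi>) - h * \<phi> \<le> \<beta> * q" using lower D by simp
  also have "\<dots> \<le> \<beta> * (2 * (h * \<phi> / a))" using upper \<beta> by (intro mult_left_mono) auto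
  finally have "d\<^sup>2 * \<phi> \<le> (h * k) * \<phi>" by (simp add: k_def power2_eq_square algebra_simps)
  with \<open>0 < \<phi>\<close> have "d\<^sup>2 \<le> h * k" by simp
  with h(3) show False by simp
qed

lemma hit_nonneg_eq:
  "hit_nonneg (shifted_process Z B \<Lambda>) = hit_nonpos (shifted_process (\<lambda>\<omega>. - Z \<omega>) (\<lambda>t \<omega>. - B t \<omega>) (\<lambda>t. - \<Lambda> t))"
proof -
  have "Z \<omega> + B t \<omega> - \<Lambda> t \<ge> 0 \<longleftrightarrow> - Z \<omega> + - B t \<omega> - - \<Lambda> t \<le> 0" for t \<omega> by linarith
  then show ?thesis by (intro ext) (simp only: hit_nonneg_def hit_nonpos_def shifted_process_def)
qed

theorem mainTheorem2:
  fixes M :: "'a measure" and \<alpha> \<beta> :: real and X0 Y0 :: "'a \<Rightarrow> real"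
    and B W X Y :: "real \<Rightarrow> 'a \<Rightarrow> real" and \<Lambda> :: "real \<Rightarrow> real"
    and \<sigma> \<tau> :: "'a \<Rightarrow> ereal"
  defines "X \<equiv> shifted_process X0 B \<Lambda>" and "Y \<equiv> shifted_process Y0 W \<Lambda>"
    and "\<sigma> \<equiv> hit_nonpos X" and "\<tau> \<equiv> hit_nonneg Y"
  assumes "prob_space M"
    and "\<alpha> > 0" and "\<beta> > 0"
    and "X0 \<in> borel_measurable M" and "AE \<omega> in M. X0 \<omega> \<ge> 0"
    and "Y0 \<in> borel_measurable M" and "AE \<omega> in M. Y0 \<omega> \<le> 0"
    and "standard_brownian_motion M B" and "indep_of_process M X0 B"
    and "standard_brownian_motion M W" and "indep_of_process M Y0 W"
    and "mckean_vlasov_solution M \<alpha> \<beta> X0 Y0 B W \<Lambda>"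
  shows "\<forall>t\<ge>0. \<Lambda> t \<noteq> left_lim 0 \<Lambda> t \<longrightarrow>
    \<bar>\<Lambda> t - left_lim 0 \<Lambda> t\<bar> \<ge>
      (if \<Lambda> t - left_lim 0 \<Lambda> t > 0
       then Inf {x. x > 0 \<and>
              \<alpha> * prob_of M (\<lambda>\<omega>. \<sigma> \<omega> \<ge> ereal t \<and> left_lim (X0 \<omega>) (\<lambda>s. X s \<omega>) t \<in> {0..x}) < x}
       else Inf {y. y > 0 \<and>
              \<beta> * prob_of M (\<lambda>\<omega>. \<tau> \<omega> \<ge> ereal t \<and> left_lim (Y0 \<omega>) (\<lambda>s. Y s \<omega>) t \<in> {-y..0}) < y})"
proof (intro allI impI)
  fix t :: real assume t: "0 \<le> t" and jump: "\<Lambda> t \<noteq> left_lim 0 \<Lambda> t"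
  let ?Z = "\<lambda>\<omega>. - Y0 \<omega>" and ?V = "\<lambda>t \<omega>. - W t \<omega>" and ?\<Lambda>' = "\<lambda>t. - \<Lambda> t"
  have cad: "cadlag \<Lambda>" using assms(16) by (simp add: mckean_vlasov_solution_def)
  have X: "driven_process M X0 B \<Lambda>" and Y': "driven_process M Y0 W \<Lambda>"
    using assms cad by (auto intro!: driven_process.intro driven_process_axioms.intro)
  have Y: "driven_process M ?Z ?V ?\<Lambda>'" by (rule driven_process_uminus[OF Y'])
  have \<tau>: "\<tau> = hit_nonpos (shifted_process ?Z ?V ?\<Lambda>')"
    unfolding \<tau>_def Y_def by (rule hit_nonneg_eq)
  have \<Lambda>: "\<Lambda> s = \<alpha> * prob_of M (\<lambda>\<omega>. \<sigma> \<omega> \<le> ereal s) - \<beta> * prob_of M (\<lambda>\<omega>. \<tau> \<omega> \<le> ereal s)" if "0 \<le> s" for s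
    using assms(16) that unfolding mckean_vlasov_solution_def \<sigma>_def X_def \<tau>_def Y_def by blast
  show "(if \<Lambda> t - left_lim 0 \<Lambda> t > 0
       then Inf {x. x > 0 \<and>
              \<alpha> * prob_of M (\<lambda>\<omega>. \<sigma> \<omega> \<ge> ereal t \<and> left_lim (X0 \<omega>) (\<lambda>s. X s \<omega>) t \<in> {0..x}) < x}
       else Inf {y. y > 0 \<and>
              \<beta> * prob_of M (\<lambda>\<omega>. \<tau> \<omega> \<ge> ereal t \<and> left_lim (Y0 \<omega>) (\<lambda>s. Y s \<omega>) t \<in> {-y..0}) < y})
    \<le> \<bar>\<Lambda> t - left_lim 0 \<Lambda> t\<bar>"
  proof (cases "left_lim 0 \<Lambda> t < \<Lambda> t")
    case True
    have "prob_of M (\<lambda>\<omega>. \<sigma> \<omega> \<ge> ereal t \<and> left_lim (X0 \<omega>) (\<lambda>s. X s \<omega>) t \<in> {0..x}) =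
        prob_of M (\<lambda>\<omega>. \<sigma> \<omega> \<ge> ereal t \<and> X0 \<omega> + B t \<omega> - left_lim 0 \<Lambda> t \<in> {0..x})" for x
    proof (rule prob_of_cong_AE)
      show "AE \<omega> in M. (\<sigma> \<omega> \<ge> ereal t \<and> left_lim (X0 \<omega>) (\<lambda>s. X s \<omega>) t \<in> {0..x}) \<longleftrightarrow>
          (\<sigma> \<omega> \<ge> ereal t \<and> X0 \<omega> + B t \<omega> - left_lim 0 \<Lambda> t \<in> {0..x})"
        using driven_process.AE_path[OF X]
        by eventually_elim (simp add: X_def driven_process.left_lim_path[OF X _ _ t])
    qed
    moreover have "Inf {x. 0 < x \<and> \<alpha> * prob_of M (\<lambda>\<omega>. ereal t \<le> \<sigma> \<omega> \<and>
        X0 \<omega> + B t \<omega> - left_lim 0 \<Lambda> t \<in> {0..x}) < x} \<le> \<Lambda> t - left_lim 0 \<Lambda> t"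
      unfolding \<sigma>_def X_def
      by (rule upward_jump_ge[OF X Y _ assms(6,7) _ t True])
        (use assms(11) \<Lambda> in \<open>auto elim!: eventually_mono simp: \<tau> \<sigma>_def X_def\<close>)
    ultimately show ?thesis using True by simp
  next
    case False
    with jump have down: "\<Lambda> t < left_lim 0 \<Lambda> t" by simp
    have L: "left_lim 0 ?\<Lambda>' t = - left_lim 0 \<Lambda> t" by (rule left_lim_uminus[OF cad t])
    have "prob_of M (\<lambda>\<omega>. \<tau> \<omega> \<ge> ereal t \<and> left_lim (Y0 \<omega>) (\<lambda>s. Y s \<omega>) t \<in> {-y..0}) =
        prob_of M (\<lambda>\<omega>. \<tau> \<omega> \<ge> ereal t \<and> - Y0 \<omega> + - W t \<omega> - left_lim 0 ?\<Lambda>' t \<in> {0..y})" for y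
    proof (rule prob_of_cong_AE)
      show "AE \<omega> in M. (\<tau> \<omega> \<ge> ereal t \<and> left_lim (Y0 \<omega>) (\<lambda>s. Y s \<omega>) t \<in> {-y..0}) \<longleftrightarrow>
          (\<tau> \<omega> \<ge> ereal t \<and> - Y0 \<omega> + - W t \<omega> - left_lim 0 ?\<Lambda>' t \<in> {0..y})"
        using driven_process.AE_path[OF Y']
        by eventually_elim (auto simp: L Y_def driven_process.left_lim_path[OF Y' _ _ t])
    qed
    moreover have "Inf {y. 0 < y \<and> \<beta> * prob_of M (\<lambda>\<omega>. ereal t \<le> \<tau> \<omega> \<and>
        - Y0 \<omega> + - W t \<omega> - left_lim 0 ?\<Lambda>' t \<in> {0..y}) < y} \<le> - \<Lambda> t - left_lim 0 ?\<Lambda>' t"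
      unfolding \<tau>
      by (rule upward_jump_ge[OF Y _ _ assms(7,6) _ t])
        (use X assms(9) \<Lambda> down L in \<open>auto simp: \<tau> \<sigma>_def X_def\<close>)
    ultimately show ?thesis using down L by simp
  qed
qed

end
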